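(* There exist constants $c_{2k}$ ($k=1,2,3,\dots$), depending only on $k$ and satisfying $c_{2k}=O(\sqrt{2k})$, such that for all integers $k\ge1$, $n\ge1$ and all $f\in T_{n-1}^\perp$, $$\|f\|\le c_{2k}\,\gamma_{2k}^*\,\omega_{2k}\left(f,\frac{\pi}{n}\right).$$
   Context: All functions are continuous and $2\pi$-periodic on $\mathbb{R}$, $\|\cdot\|$ is the uniform norm, and $T_{n-1}^\perp$ is the set of such $f$ with $\int_{-\pi}^{\pi}f(x)\tau(x)\,dx=0$ for all trigonometric polynomials $\tau$ of degree $\le n-1$. The modulus of smoothness is $\omega_{r}(f,\delta)=\sup_{0<t\le\delta}\|\Delta_t^r(f,\cdot)\|$, where $\Delta_t^r(f,x)=\sum_{i=0}^r(-1)^i\binom{r}{i}f(x+it)$. $\gamma_{2k}^*=\binom{2k}{k}^{-1}$. *)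

theory Defs
  imports "HOL-Analysis.Analysis" "HOL-Library.Landau_Symbols"
begin

definition cont_periodic :: "(real \<Rightarrow> real) \<Rightarrow> bool" where
  "cont_periodic f \<longleftrightarrow> continuous_on UNIV f \<and> (\<forall>x. f (x + 2 * pi) = f x)"

definition trig_poly :: "nat \<Rightarrow> (real \<Rightarrow> real) \<Rightarrow> bool" where
  "trig_poly m \<tau> \<longleftrightarrow>
     (\<exists>a b :: nat \<Rightarrow> real. \<forall>x.
        \<tau> x = a 0 + (\<Sum>j=1..m. a j * cos (real j * x) + b j * sin (real j * x)))"

text \<open>The space \<open>T_m\<close>-perp, where \<open>T_m\<close> are the trigonometric polynomials of degree at most \<open>m\<close>.\<close>

definition trig_perp :: "nat \<Rightarrow> (real \<Rightarrow> real) set" where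
  "trig_perp m =
     {f. cont_periodic f \<and> (\<forall>\<tau>. trig_poly m \<tau> \<longrightarrow> integral {-pi..pi} (\<lambda>x. f x * \<tau> x) = 0)}"

text \<open>The suprema below are taken in the reals, so they have their intended meaning only for
  bounded \<open>f\<close> and, in the modulus of smoothness, for \<open>\<delta> > 0\<close>. Every continuous periodic \<open>f\<close> is
  bounded, and then the norms of its \<open>r\<close>-th differences are at most \<open>2 ^ r\<close> times that of \<open>f\<close>.\<close>

definition unif_norm :: "(real \<Rightarrow> real) \<Rightarrow> real" where
  "unif_norm f = (SUP x. \<bar>f x\<bar>)"

definition fin_diff :: "nat \<Rightarrow> real \<Rightarrow> (real \<Rightarrow> real) \<Rightarrow> real \<Rightarrow> real" where
  "fin_diff r t f x = (\<Sum>i=0..r. (-1) ^ i * real (r choose i) * f (x + real i * t))"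

definition mod_smooth :: "nat \<Rightarrow> (real \<Rightarrow> real) \<Rightarrow> real \<Rightarrow> real" where
  "mod_smooth r f \<delta> = (SUP t\<in>{0<..\<delta>}. unif_norm (fin_diff r t f))"

text \<open>Indexed by \<open>k\<close>, so that \<open>gamma_star_even k\<close> is \<open>\<gamma>\<^sup>*\<close> at the even index \<open>2 * k\<close>.\<close>

definition gamma_star_even :: "nat \<Rightarrow> real" where
  "gamma_star_even k = inverse (real ((2 * k) choose k))"

end

theory Submission
  imports Defs
begin

text \<open>
  Put \<open>h = \<pi> / n\<close>. In the central difference of order \<open>2 k\<close> of \<open>f\<close> with step \<open>t\<close>, divided by its
  middle coefficient, the value \<open>f x\<close> stands isolated; the other terms are
  \<open>(-1) ^ i * a i * (f (x + i t) + f (x - i t))\<close> with \<open>0 \<le> a i \<le> 1\<close> and \<open>1 \<le> i \<le> k\<close>. Averaging over \<open>0 < t \<le> h\<close> with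
  the weight \<open>h - t\<close> turns these into second differences of a double antiderivative of \<open>f\<close>. So
  \<open>f = W + Q (D f)\<close>, where \<open>W\<close> is bounded by \<open>\<gamma>\<^sup>*\<close> times the modulus of smoothness, \<open>D\<close> is double
  integration multiplied by \<open>- n\<^sup>2\<close>, and \<open>Q\<close> is a combination of translations. For this choice of \<open>h\<close>
  the norm of \<open>Q\<close> is at most \<open>\<rho> = (8 / \<pi>\<^sup>2) * (\<Sum> a i / i\<^sup>2)\<close>, the sum running over odd \<open>i \<le> k\<close>
  (lemma \<open>averaged_difference\<close>). With all \<open>a i = 1\<close> and unlimited \<open>i\<close>, \<open>\<rho>\<close> would be exactly 1;
  because \<open>a i\<close> is well below 1 once \<open>i\<close> exceeds \<open>sqrt k\<close>, the quantity \<open>1 - \<rho>\<close> is at least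
  \<open>1 / (\<pi>\<^sup>2 sqrt k)\<close> (lemma \<open>odd_central_sum_le\<close>).

  The operator \<open>D\<close> has norm greater than 1 in the uniform metric, so \<open>\<rho> < 1\<close> does not by itself
  make \<open>Q D\<close> a contraction. But all powers \<open>D ^ m\<close> have norm at most 3 on functions without
  frequencies below \<open>n\<close> (lemma \<open>inverse_power_op_bound\<close>). Therefore the equivalent norm
  \<open>sup {\<parallel>D ^ m f\<parallel> | m}\<close> satisfies \<open>M \<le> 3 \<gamma>\<^sup>* \<omega> + \<rho> M\<close>, and \<open>\<parallel>f\<parallel> \<le> M \<le> 3 \<pi>\<^sup>2 sqrt k \<gamma>\<^sup>* \<omega>\<close>.

  The uniform bound for the powers comes from a kernel. The multiplier of \<open>D ^ m\<close> is
  \<open>(n / l) ^ (2 m)\<close> for \<open>l \<ge> n\<close>, and its values for \<open>l < n\<close> may be chosen freely. Reflecting it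
  at \<open>n\<close> gives a peak that is convex on both sides; up to a small correction the kernel is then
  \<open>2 cos (n y)\<close> times a cosine series with convex coefficients, which is nonnegative
  (lemma \<open>cos_kernel_nonneg\<close>), so that its mass is known. That the kernel represents repeated
  integration follows from uniqueness of Fourier coefficients (lemma \<open>cos_coeff_unique\<close>).
\<close>

section \<open>Antiderivatives of periodic functions\<close>

lemma global_antiderivative:
  fixes f :: "real \<Rightarrow> real"
  assumes "continuous_on UNIV f"
  obtains F where "\<And>x. (F has_real_derivative f x) (at x)"
proof -
  have "\<exists>F. \<forall>x::real. (-\<infinity>::ereal) < x \<longrightarrow> x < (\<infinity>::ereal) \<longrightarrow> (F has_vector_derivative f x) (at x)"
    by (rule einterval_antiderivative) (use assms in \<open>auto simp: continuous_on_eq_continuous_at\<close>)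
  then show thesis
    using that by (auto simp: has_real_derivative_iff_has_vector_derivative)
qed

lemma has_integral_antiderivative:
  fixes F f :: "real \<Rightarrow> real"
  assumes "a \<le> b" "\<And>x. (F has_real_derivative f x) (at x)"
  shows "(f has_integral (F b - F a)) {a..b}"
  by (rule fundamental_theorem_of_calculus)
     (use assms in \<open>auto simp: has_real_derivative_iff_has_vector_derivative[symmetric]
        intro: has_field_derivative_at_within\<close>)

lemma DERIV_affine:
  fixes F f :: "real \<Rightarrow> real"
  assumes "\<And>x. (F has_real_derivative f x) (at x)"
  shows "((\<lambda>y. F (a + c * y)) has_real_derivative f (a + c * y) * c) (at y within S)"
  by (rule has_field_derivative_at_within, rule DERIV_chain2[OF assms])
     (auto intro!: derivative_eq_intros)

lemma cont_periodic_continuous_on: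
  assumes "cont_periodic f" "continuous_on S g"
  shows "continuous_on S (\<lambda>x. f (g x))"
  using assms continuous_on_compose2[of UNIV f S g] by (auto simp: cont_periodic_def)

lemma integral_periodic_shift:
  assumes "cont_periodic f"
  shows "integral {-pi..pi} (\<lambda>y. f (x + y)) = integral {-pi..pi} f"
proof -
  obtain F where F: "\<And>x. (F has_real_derivative f x) (at x)"
    using global_antiderivative assms unfolding cont_periodic_def by blast
  have int: "integral {-pi..pi} (\<lambda>y. f (z + y)) = F (z - pi + 2 * pi) - F (z - pi)" for z
  proof -
    have "((\<lambda>y. F (z + y)) has_real_derivative f (z + y)) (at y)" for y
      using DERIV_affine[OF F, of z 1] by simp
    then have "((\<lambda>y. f (z + y)) has_integral (F (z + pi) - F (z + (-pi)))) {-pi..pi}"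
      by (intro has_integral_antiderivative[where F = "\<lambda>y. F (z + y)"]) auto
    then show ?thesis by (simp add: integral_unique algebra_simps)
  qed
  have "((\<lambda>x. F (x + 2 * pi) - F x) has_real_derivative 0) (at x)" for x
  proof -
    have "((\<lambda>x. F (x + 2 * pi) - F x) has_real_derivative (f (x + 2 * pi) * 1 - f x)) (at x)"
      by (intro derivative_intros DERIV_chain2[OF F] F)  (auto intro!: derivative_eq_intros)
    then show ?thesis using assms by (simp add: cont_periodic_def)
  qed
  then have "F (x - pi + 2 * pi) - F (x - pi) = F (0 - pi + 2 * pi) - F (0 - pi)"
    using DERIV_isconst_all[of "\<lambda>x. F (x + 2 * pi) - F x"] by blast
  then show ?thesis
    using int[of x] int[of 0] by simp
qed

lemma periodic_antiderivative:
  assumes f: "cont_periodic f" and mean: "integral {-pi..pi} f = 0"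
  obtains F where "cont_periodic F" "integral {-pi..pi} F = 0"
    "\<And>x. (F has_real_derivative f x) (at x)"
proof -
  obtain F where F: "\<And>x. (F has_real_derivative f x) (at x)"
    using global_antiderivative f unfolding cont_periodic_def by blast
  have per: "F (x + 2 * pi) = F x" for x
  proof -
    have "((\<lambda>y. F (x + pi + y)) has_real_derivative f (x + pi + y)) (at y)" for y
      using DERIV_affine[OF F, of "x + pi" 1] by simp
    then have "((\<lambda>y. f (x + pi + y)) has_integral (F (x + pi + pi) - F (x + pi + (-pi)))) {-pi..pi}"
      by (intro has_integral_antiderivative[where F = "\<lambda>y. F (x + pi + y)"]) auto
    then show ?thesis
      using integral_periodic_shift[OF f, of "x + pi"] mean by (simp add: integral_unique algebra_simps)
  qed
  have cont: "continuous_on UNIV F"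
    using F by (meson DERIV_isCont continuous_at_imp_continuous_on)
  define c where "c = integral {-pi..pi} F / (2 * pi)"
  show thesis
  proof (rule that[of "\<lambda>x. F x - c"])
    show "cont_periodic (\<lambda>x. F x - c)"
      using per cont by (auto simp: cont_periodic_def intro!: continuous_intros)
    have "F integrable_on {-pi..pi}"
      by (rule integrable_continuous_interval) (rule continuous_on_subset[OF cont], simp)
    then show "integral {-pi..pi} (\<lambda>x. F x - c) = 0"
      by (subst Henstock_Kurzweil_Integration.integral_diff) (auto simp: c_def)
    show "((\<lambda>x. F x - c) has_real_derivative f x) (at x)" for x
      using DERIV_diff[OF F DERIV_const] by simp
  qed
qed

section \<open>Uniqueness of Fourier coefficients\<close>

text \<open>This is \<open>2 \<pi>\<close> or \<open>\<pi>\<close> times the value at \<open>x\<close> of the \<open>j\<close>-th term of the Fourier series of \<open>f\<close>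
  (according to whether \<open>j = 0\<close>): moving the centre to \<open>x\<close> makes the sine coefficients redundant.\<close>
definition cos_coeff :: "nat \<Rightarrow> (real \<Rightarrow> real) \<Rightarrow> real \<Rightarrow> real" where
  "cos_coeff j f x = integral {-pi..pi} (\<lambda>y. f (x + y) * cos (real j * y))"

lemma cos_product_step:
  "2 * cos (real (Suc i) * y) * cos y = cos (real (Suc (Suc i)) * y) + cos (real i * y)"
proof -
  have 1: "real (Suc (Suc i)) * y = real (Suc i) * y + y"
    unfolding of_nat_Suc[of "Suc i"] by (simp only: distrib_right mult_1 add.commute)
  have 2: "real i * y = real (Suc i) * y - y"
    unfolding of_nat_Suc by (simp only: distrib_right mult_1 add_diff_cancel_left')
  show ?thesis unfolding 1 2 cos_add cos_diff by (simp only: mult.assoc)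
qed

lemma orthogonal_cos_powers:
  assumes g: "continuous_on {-pi..pi} g"
    and g0: "\<And>j. integral {-pi..pi} (\<lambda>y. g y * cos (real j * y)) = 0"
  shows "integral {-pi..pi} (\<lambda>y. g y * (cos y ^ p * cos (real j * y))) = 0"
proof (induction p arbitrary: j)
  case 0
  then show ?case using g0 by simp
next
  case (Suc p)
  have int: "(\<lambda>y. g y * (cos y ^ p * cos (real j * y))) integrable_on {-pi..pi}" for j
    by (intro integrable_continuous_interval continuous_intros g)
  show ?case
  proof (cases j)
    case 0
    have "g y * (cos y ^ Suc p * cos (real j * y)) = g y * (cos y ^ p * cos (real 1 * y))" for y
      using 0 by simp
    then show ?thesis using Suc[of 1] by presburger
  next
    case (Suc i)
    have "g y * (cos y ^ Suc p * cos (real j * y)) =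
      1 / 2 * (g y * (cos y ^ p * cos (real (Suc j) * y)) + g y * (cos y ^ p * cos (real i * y)))" for y
    proof -
      have "g y * (cos y ^ Suc p * cos (real j * y)) =
          1 / 2 * (g y * cos y ^ p * (2 * cos (real j * y) * cos y))" by simp
      then show ?thesis unfolding Suc cos_product_step by (simp only: distrib_left mult.assoc)
    qed
    then have "integral {-pi..pi} (\<lambda>y. g y * (cos y ^ Suc p * cos (real j * y))) =
      1 / 2 * (integral {-pi..pi} (\<lambda>y. g y * (cos y ^ p * cos (real (Suc j) * y)))
        + integral {-pi..pi} (\<lambda>y. g y * (cos y ^ p * cos (real i * y))))"
      by (simp only: integral_mult_right Henstock_Kurzweil_Integration.integral_add[OF int int])
    then show ?thesis
      by (simp only: Suc.IH) simp
  qed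
qed

text \<open>A polynomial in \<open>cos y\<close> is a combination of the functions \<open>cos (j y)\<close>. Orthogonality to all
  \<open>cos y ^ p * cos (j y)\<close> is the form of this fact that goes through an induction on \<open>p\<close>.\<close>
lemma orthogonal_cos_polynomial:
  assumes g: "continuous_on {-pi..pi} g"
    and g0: "\<And>j. integral {-pi..pi} (\<lambda>y. g y * cos (real j * y)) = 0"
    and p: "real_polynomial_function p"
  shows "integral {-pi..pi} (\<lambda>y. g y * p (cos y)) = 0"
proof -
  obtain a n where p: "p = (\<lambda>x. \<Sum>i\<le>n. a i * x ^ i)"
    using p real_polynomial_function_iff_sum by blast
  have "integral {-pi..pi} (\<lambda>y. g y * p (cos y)) =
        integral {-pi..pi} (\<lambda>y. \<Sum>i\<le>n. a i * (g y * cos y ^ i))"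
    by (simp add: p sum_distrib_left mult.left_commute)
  also have "\<dots> = (\<Sum>i\<le>n. integral {-pi..pi} (\<lambda>y. a i * (g y * cos y ^ i)))"
    by (intro integral_sum integrable_continuous_interval continuous_intros g) simp
  also have "\<dots> = 0"
    using orthogonal_cos_powers[OF g g0, of _ 0] by simp
  finally show ?thesis .
qed

text \<open>An even \<open>g\<close> is \<open>G (cos y)\<close> with \<open>G\<close> continuous on \<open>[-1, 1]\<close>, so by Weierstrass it is a uniform
  limit of functions \<open>p (cos y)\<close> with \<open>p\<close> a polynomial. If all of these are orthogonal to \<open>g\<close>, then
  so is \<open>g\<close> itself.\<close>
lemma even_orthogonal_cos_eq_zero:
  assumes g: "continuous_on UNIV g" and even: "\<And>y. g (- y) = g y"
    and g0: "\<And>j. integral {-pi..pi} (\<lambda>y. g y * cos (real j * y)) = 0"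
  shows "g 0 = 0"
proof -
  have gI: "continuous_on S g" for S using g continuous_on_subset by blast
  obtain B where B: "\<And>y. y \<in> {-pi..pi} \<Longrightarrow> \<bar>g y\<bar> \<le> B"
    using compact_imp_bounded[OF compact_continuous_image[OF gI[of "{-pi..pi}"] compact_Icc]]
    unfolding bounded_real by blast
  have B0: "B \<ge> 0" using B[of 0] by simp
  have g2: "(\<lambda>y. g y * g y) integrable_on {-pi..pi}"
    by (intro integrable_continuous_interval continuous_intros gI)
  have "integral {-pi..pi} (\<lambda>y. g y * g y) \<le> 0 + e" if e: "e > 0" for e
  proof -
    define d where "d = e / (2 * pi * (B + 1))"
    have d: "d > 0" using e B0 by (simp add: d_def)
    have "continuous_on {-1..1} (\<lambda>t. g (arccos t))"
      by (rule continuous_on_compose2[OF g continuous_on_arccos']) simp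
    then obtain p where p: "real_polynomial_function p"
        and pd: "\<And>t. t \<in> {-1..1} \<Longrightarrow> \<bar>g (arccos t) - p t\<bar> < d"
      by (rule Stone_Weierstrass_real_polynomial_function[OF compact_Icc _ d]) blast
    have cl: "\<bar>g y - p (cos y)\<bar> \<le> d" if "y \<in> {-pi..pi}" for y
    proof -
      have "g \<bar>y\<bar> = g y" using even by (simp add: abs_if)
      moreover have "arccos (cos y) = \<bar>y\<bar>"
        using arccos_cos[of "\<bar>y\<bar>"] that by (simp add: abs_le_iff)
      ultimately show ?thesis
        using pd[of "cos y"] by simp
    qed
    have pc: "continuous_on {-pi..pi} (\<lambda>y. p (cos y))"
      using p unfolding real_polynomial_function_eq
      by (rule continuous_on_compose2[of UNIV p, OF continuous_on_polymonial_function])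
        (auto intro!: continuous_intros)
    have gp: "(\<lambda>y. g y * p (cos y)) integrable_on {-pi..pi}"
      by (intro integrable_continuous_interval continuous_on_mult gI pc)
    have "integral {-pi..pi} (\<lambda>y. g y * g y) = integral {-pi..pi} (\<lambda>y. g y * g y - g y * p (cos y))"
      using Henstock_Kurzweil_Integration.integral_diff[OF g2 gp] orthogonal_cos_polynomial[OF gI g0 p] 
      by simp
    also have "\<dots> \<le> integral {-pi..pi} (\<lambda>y. (B + 1) * d)"
    proof (rule integral_le)
      fix y assume y: "y \<in> {-pi..pi}"
      have "g y * g y - g y * p (cos y) = g y * (g y - p (cos y))"
        by (simp add: right_diff_distrib)
      also have "\<dots> \<le> \<bar>g y\<bar> * \<bar>g y - p (cos y)\<bar>"
        by (metis abs_ge_self abs_mult)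
      also have "\<dots> \<le> (B + 1) * d"
        using B[OF y] cl[OF y] B0 by (intro mult_mono) auto
      finally show "g y * g y - g y * p (cos y) \<le> (B + 1) * d" .
    next
      show "(\<lambda>y. g y * g y - g y * p (cos y)) integrable_on {-pi..pi}"
        by (rule integrable_diff[OF g2 gp])
    qed (rule integrable_const_ivl)
    also have "\<dots> = e" using B0 by (simp add: d_def)
    finally show ?thesis by simp
  qed
  then have "integral {-pi..pi} (\<lambda>y. g y * g y) \<le> 0"
    by (rule field_le_epsilon)
  moreover have "integral {-pi..pi} (\<lambda>y. g y * g y) \<ge> 0"
    by (intro Henstock_Kurzweil_Integration.integral_nonneg g2) auto
  ultimately have "integral {-pi..pi} (\<lambda>y. g y * g y) = 0" by simp
  then have "\<forall>y\<in>{-pi..pi}. g y * g y = 0"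
    by (subst (asm) integral_eq_0_iff) (auto intro!: continuous_on_mult gI)
  then show "g 0 = 0" by auto
qed

text \<open>Only the even part of \<open>f\<close> around \<open>x\<close> influences both \<open>f x\<close> and these coefficients. This makes
  uniqueness of Fourier series a pointwise statement that mentions cosines only.\<close>
lemma cos_coeff_unique:
  assumes f: "cont_periodic f" and zero: "\<And>j. cos_coeff j f x = 0"
  shows "f x = 0"
proof -
  note fI = cont_periodic_continuous_on[OF f]
  define g where "g = (\<lambda>y. f (x + y) + f (x - y))"
  have g0: "integral {-pi..pi} (\<lambda>y. g y * cos (real j * y)) = 0" for j
  proof -
    have i1: "(\<lambda>y. f (x + y) * cos (real j * y)) integrable_on {-pi..pi}"
      by (intro integrable_continuous_interval continuous_intros fI)
    have i2: "(\<lambda>y. f (x - y) * cos (real j * y)) integrable_on {-pi..pi}"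
      by (intro integrable_continuous_interval continuous_intros fI)
    have "integral {-pi..pi} (\<lambda>y. f (x - y) * cos (real j * y)) =
          integral {-pi..pi} (\<lambda>y. f (x + y) * cos (real j * y))"
      using Henstock_Kurzweil_Integration.integral_reflect_real[of pi "-pi" "\<lambda>y. f (x + y) * cos (real j * y)"]
      by (simp del: Henstock_Kurzweil_Integration.integral_reflect_real)
    then show ?thesis
      using Henstock_Kurzweil_Integration.integral_add[OF i1 i2] zero[of j]
      by (simp add: g_def cos_coeff_def distrib_right)
  qed
  have "g 0 = 0"
  proof (rule even_orthogonal_cos_eq_zero)
    show "continuous_on UNIV g" unfolding g_def by (intro continuous_intros fI)
  qed (simp_all add: g0, simp add: g_def)
  then show ?thesis by (simp add: g_def)
qed

section \<open>Cosine series with convex coefficients\<close>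

definition cos_kernel :: "(nat \<Rightarrow> real) \<Rightarrow> real \<Rightarrow> real" where
  "cos_kernel q y = (\<Sum>i. (if i = 0 then 1 else 2) * q i * cos (real i * y))"

lemma cos_kernel_uniform_limit:
  assumes "\<And>j. q j \<ge> 0" "summable q"
  shows "uniform_limit A (\<lambda>N y. \<Sum>i<N. (if i = 0 then 1 else 2) * q i * cos (real i * y))
    (cos_kernel q) sequentially"
  unfolding cos_kernel_def[abs_def]
proof (rule Weierstrass_m_test)
  fix i and y :: real
  have "\<bar>cos (real i * y)\<bar> * q i \<le> 1 * q i"
    by (intro mult_right_mono) (use assms in auto)
  then show "norm ((if i = 0 then 1 else 2) * q i * cos (real i * y)) \<le> 2 * q i"
    using assms(1)[of i] by (auto simp: abs_mult mult.commute)
qed (use assms in \<open>simp add: summable_mult\<close>)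

lemma cos_kernel_continuous:
  assumes "\<And>j. q j \<ge> 0" "summable q"
  shows "continuous_on S (cos_kernel q)"
proof (rule uniform_limit_theorem[OF _ cos_kernel_uniform_limit[OF assms]])
  show "\<forall>\<^sub>F N in sequentially. continuous_on S
      (\<lambda>y. \<Sum>i<N. (if i = 0 then 1 else 2) * q i * cos (real i * y))"
    by (intro always_eventually allI continuous_intros)
qed simp

lemma integral_cos:
  "((\<lambda>y. cos (of_int i * y)) has_integral (if i = 0 then 2 * pi else 0)) {-pi..pi}"
proof (cases "i = 0")
  case True
  then show ?thesis using has_integral_const_real[of "1::real" "-pi" pi] by simp
next
  case False
  have "((\<lambda>y. sin (of_int i * y) / of_int i) has_real_derivative cos (of_int i * y)) (at y)" for y :: real
    using False by (auto intro!: derivative_eq_intros)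
  from has_integral_antiderivative[OF _ this, of "-pi" pi]
  show ?thesis using False by (simp add: mult.commute)
qed

lemma integral_cos_cos:
  "((\<lambda>y. cos (real i * y) * cos (real l * y)) has_integral
     (if i = l then if i = 0 then 2 * pi else pi else 0)) {-pi..pi}"
proof -
  have "((\<lambda>y. 1 / 2 * (cos (of_int (int i - int l) * y) + cos (of_int (int i + int l) * y))) has_integral
     1 / 2 * ((if int i - int l = 0 then 2 * pi else 0) + (if int i + int l = 0 then 2 * pi else 0))) {-pi..pi}"
    by (intro has_integral_mult_right has_integral_add integral_cos)
  moreover have "1 / 2 * (cos (of_int (int i - int l) * y) + cos (of_int (int i + int l) * y)) =
      cos (real i * y) * cos (real l * y)" for y
    by (simp add: left_diff_distrib distrib_right cos_add cos_diff)
  moreover have "1 / 2 * ((if int i - int l = 0 then 2 * pi else 0) + (if int i + int l = 0 then 2 * pi else 0))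
      = (if i = l then if i = 0 then 2 * pi else pi else 0)"
    by auto
  ultimately show ?thesis by simp
qed

lemma cos_kernel_coeff:
  assumes "\<And>j. q j \<ge> 0" "summable q"
  shows "integral {-pi..pi} (\<lambda>y. cos_kernel q y * cos (real l * y)) = 2 * pi * q l"
proof -
  let ?w = "\<lambda>i. (if i = 0 then 1 else 2) * q i"
  let ?P = "\<lambda>N y. \<Sum>i<N. ?w i * (cos (real i * y) * cos (real l * y))"
  have "uniform_limit {-pi..pi} (\<lambda>N y. (\<Sum>i<N. ?w i * cos (real i * y)) * cos (real l * y))
    (\<lambda>y. cos_kernel q y * cos (real l * y)) sequentially"
  proof (rule uniform_lim_mult[OF cos_kernel_uniform_limit[OF assms] uniform_limit_const])
    show "bounded (cos_kernel q ` {-pi..pi})"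
      by (intro compact_imp_bounded compact_continuous_image cos_kernel_continuous assms) simp
    show "bounded ((\<lambda>y. cos (real l * y)) ` {-pi..pi})"
      by (rule boundedI[of _ 1]) auto
  qed
  then have ul: "uniform_limit {-pi..pi} ?P (\<lambda>y. cos_kernel q y * cos (real l * y)) sequentially"
    by (simp add: sum_distrib_right mult.assoc)
  obtain I J where I: "\<And>N. (?P N has_integral I N) {-pi..pi}"
    and J: "((\<lambda>y. cos_kernel q y * cos (real l * y)) has_integral J) {-pi..pi}"
    and lim: "I \<longlonglongrightarrow> J"
    by (rule uniform_limit_integral[OF ul]) (auto intro!: continuous_intros)
  have "I N = 2 * pi * q l" if "N > l" for N
  proof -
    have "(?P N has_integral (\<Sum>i<N. ?w i * (if i = l then if i = 0 then 2 * pi else pi else 0))) {-pi..pi}"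
      by (intro has_integral_sum has_integral_mult_right integral_cos_cos) simp
    then have "I N = (\<Sum>i<N. ?w i * (if i = l then if i = 0 then 2 * pi else pi else 0))"
      using I has_integral_unique by blast
    also have "\<dots> = (\<Sum>i<N. if i = l then 2 * pi * q l else 0)"
      by (intro sum.cong) auto
    also have "\<dots> = 2 * pi * q l" using that by simp
    finally show ?thesis .
  qed
  then have "\<forall>\<^sub>F N in sequentially. I N = 2 * pi * q l"
    unfolding eventually_sequentially by (meson Suc_le_lessD)
  then have "I \<longlonglongrightarrow> 2 * pi * q l" by (rule tendsto_eventually)
  then have "J = 2 * pi * q l" using lim LIMSEQ_unique by blast
  then show ?thesis using J by (simp add: integral_unique)
qed

text \<open>Multiplication by \<open>2 (1 - cos y)\<close> turns the coefficients of the cosine series into second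
  differences. For convex \<open>q\<close> these have one sign away from index 0, so the product is at least its
  value with every cosine replaced by 1, and there the series telescopes to 0.\<close>
lemma cos_kernel_nonneg:
  assumes q: "\<And>j. q j \<ge> 0" "summable q"
    and convex: "\<And>j. 2 * q (Suc j) \<le> q j + q (Suc (Suc j))"
  shows "cos_kernel q y \<ge> 0"
proof (cases "cos y = 1")
  case True
  then have "sin y = 0" using sin_cos_squared_add[of y] by simp
  with True have "cos (real j * y) = 1 \<and> sin (real j * y) = 0" for j
    by (induction j) (simp_all add: distrib_right cos_add sin_add)
  then have "cos_kernel q y = (\<Sum>i. (if i = 0 then 1 else 2) * q i)"
    by (simp add: cos_kernel_def)
  moreover have "summable (\<lambda>i. (if i = 0 then 1 else 2) * q i)"
    by (rule summable_comparison_test'[OF summable_mult[OF q(2), of 2], of 0]) (use q in auto)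
  ultimately show ?thesis
    using q(1) by (simp add: suminf_nonneg)
next
  case False
  define c where "c j = cos (real j * y)" for j
  have c1: "\<bar>c j\<bar> \<le> 1" for j by (simp add: c_def)
  have sm: "summable (\<lambda>j. q (j + a) * c (j + b))" for a b
  proof (rule summable_comparison_test'[of "\<lambda>j. q (j + a)" 0])
    show "summable (\<lambda>j. q (j + a))" using q summable_iff_shift by blast
    show "norm (q (j + a) * c (j + b)) \<le> q (j + a)" for j
      using mult_left_mono[OF c1 q(1)] q(1) by (simp add: abs_mult)
  qed
  define S where "S = (\<Sum>j. q (j + 1) * c (j + 1))"
  define X where "X = (\<Sum>j. q j * c (j + 1))"
  define Y where "Y = (\<Sum>j. q (j + 2) * c (j + 1))"
  have K: "cos_kernel q y = q 0 + 2 * S"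
  proof -
    have "summable (\<lambda>i. (if i = 0 then 1 else 2) * q i * cos (real i * y))"
      by (subst summable_Suc_iff[symmetric])
        (use summable_mult[OF sm[of 1 1], of 2] in \<open>simp add: c_def mult.assoc\<close>)
    from suminf_split_head[OF this] show ?thesis
      using suminf_mult[OF sm[of 1 1], of 2]
      unfolding cos_kernel_def S_def c_def by (simp add: mult.assoc)
  qed
  have cc: "2 * cos y * c (j + 1) = c (j + 2) + c j" for j
    using cos_product_step[of j y] by (simp add: c_def mult_ac)
  \<comment> \<open>\<open>X\<close>, \<open>S\<close> and \<open>Y\<close> are the cosine series with coefficients \<open>q\<close> shifted by 0, 1 and 2;
    together they form the series of second differences.\<close>
  have "2 * cos y * S = (\<Sum>j. q (j + 1) * (2 * cos y * c (j + 1)))"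
    unfolding S_def using suminf_mult[OF sm[of 1 1], of "2 * cos y"] by (simp add: mult_ac)
  also have "\<dots> = (\<Sum>j. q (j + 1) * c (j + 2)) + (\<Sum>j. q (j + 1) * c j)"
    unfolding cc distrib_left using suminf_add[OF sm[of 1 2] sm[of 1 0]] by simp
  also have "(\<Sum>j. q (j + 1) * c (j + 2)) = X - q 0 * c 1"
    using suminf_split_head[OF sm[of 0 1]] by (simp add: X_def)
  also have "(\<Sum>j. q (j + 1) * c j) = Y + q 1"
    using suminf_split_head[OF sm[of 1 0]] by (simp add: Y_def c_def)
  finally have "2 * (1 - cos y) * cos_kernel q y = 2 * (q 0 - q 1) - 2 * (X - 2 * S + Y)"
    unfolding K by (simp add: algebra_simps c_def)
  moreover have "X - 2 * S + Y \<le> q 0 - q 1"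
  proof -
    have s0: "summable q" and s1: "summable (\<lambda>j. q (j + 1))" and s2: "summable (\<lambda>j. q (j + 2))"
      using q summable_iff_shift by blast+
    have "(\<lambda>j. q j * c (j + 1) - 2 * (q (j + 1) * c (j + 1)) + q (j + 2) * c (j + 1)) sums (X - 2 * S + Y)"
      unfolding X_def S_def Y_def
      using sm[of 0 1] sm[of 1 1] sm[of 2 1]
      by (intro sums_add sums_diff sums_mult summable_sums) auto
    moreover have "(\<lambda>j. q j - 2 * q (j + 1) + q (j + 2)) sums (suminf q - 2 * (suminf q - q 0) + (suminf q - q 0 - q 1))"
    proof (intro sums_add sums_diff sums_mult)
      show "q sums suminf q" using s0 by (rule summable_sums)
      show "(\<lambda>j. q (j + 1)) sums (suminf q - q 0)"
        using s0 sums_split_initial_segment[of q "suminf q" 1] by (simp add: summable_sums)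
      show "(\<lambda>j. q (j + 2)) sums (suminf q - q 0 - q 1)"
        using s0 sums_split_initial_segment[of q "suminf q" 2]
        by (simp add: summable_sums numeral_2_eq_2 diff_diff_eq)
    qed
    moreover have "q j * c (j + 1) - 2 * (q (j + 1) * c (j + 1)) + q (j + 2) * c (j + 1)
        \<le> q j - 2 * q (j + 1) + q (j + 2)" for j
    proof -
      have "(q j - 2 * q (j + 1) + q (j + 2)) * c (j + 1) \<le> (q j - 2 * q (j + 1) + q (j + 2)) * 1"
        using convex[of j] c1[of "j + 1"] by (intro mult_left_mono) auto
      then show ?thesis by (simp add: algebra_simps)
    qed
    ultimately have "X - 2 * S + Y \<le> suminf q - 2 * (suminf q - q 0) + (suminf q - q 0 - q 1)"
      by (rule sums_le[rotated 1])
    then show ?thesis by simp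
  qed
  ultimately have "2 * (1 - cos y) * cos_kernel q y \<ge> 0" by simp
  moreover have "1 - cos y > 0" using False cos_le_one[of y] by linarith
  ultimately show ?thesis by (simp add: zero_le_mult_iff)
qed

lemma cos_kernel_even: "cos_kernel q (- y) = cos_kernel q y"
  by (simp add: cos_kernel_def)

section \<open>Convolution on the circle\<close>

text \<open>For an even kernel, the only case of interest here, this correlation is the convolution.\<close>
definition circle_conv :: "(real \<Rightarrow> real) \<Rightarrow> (real \<Rightarrow> real) \<Rightarrow> real \<Rightarrow> real" where
  "circle_conv \<kappa> f x = integral {-pi..pi} (\<lambda>y. f (x + y) * \<kappa> y) / (2 * pi)"

lemma circle_conv_integrand_continuous:
  assumes "cont_periodic f" "continuous_on UNIV \<kappa>"
  shows "continuous_on S (\<lambda>y. f (x + y) * \<kappa> y)"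
  using assms(2) by (intro continuous_intros cont_periodic_continuous_on[OF assms(1)])
    (auto intro: continuous_on_subset)

lemma circle_conv_cont_periodic:
  assumes f: "cont_periodic f" and k: "continuous_on UNIV \<kappa>"
  shows "cont_periodic (circle_conv \<kappa> f)"
proof -
  have "continuous_on (UNIV \<times> cbox (-pi) pi) (\<lambda>(x, y). f (x + y) * \<kappa> y)"
    unfolding split_beta
    by (intro continuous_intros cont_periodic_continuous_on[OF f] continuous_on_compose2[OF k]) auto
  then have "continuous_on UNIV (\<lambda>x. integral (cbox (-pi) pi) (\<lambda>y. f (x + y) * \<kappa> y))"
    by (rule integral_continuous_on_param)
  moreover have "f (x + 2 * pi + y) = f (x + y)" for x y
    using f unfolding cont_periodic_def by (metis add.assoc add.commute)
  ultimately show ?thesis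
    by (simp add: cont_periodic_def circle_conv_def continuous_on_divide)
qed

lemma circle_conv_bound:
  assumes f: "cont_periodic f" and k: "continuous_on UNIV \<kappa>"
    and L: "integral {-pi..pi} (\<lambda>y. \<bar>\<kappa> y\<bar>) \<le> 2 * pi * L"
    and B: "\<And>x. \<bar>f x\<bar> \<le> B"
  shows "\<bar>circle_conv \<kappa> f x\<bar> \<le> L * B"
proof -
  have B0: "B \<ge> 0" using B[of 0] by linarith
  have "norm (integral {-pi..pi} (\<lambda>y. f (x + y) * \<kappa> y)) \<le> integral {-pi..pi} (\<lambda>y. B * \<bar>\<kappa> y\<bar>)"
  proof (rule Henstock_Kurzweil_Integration.integral_norm_bound_integral)
    show "(\<lambda>y. f (x + y) * \<kappa> y) integrable_on {-pi..pi}"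
      by (intro integrable_continuous_interval circle_conv_integrand_continuous f k)
    show "(\<lambda>y. B * \<bar>\<kappa> y\<bar>) integrable_on {-pi..pi}"
      by (intro integrable_continuous_interval continuous_intros continuous_on_subset[OF k]) simp
    show "norm (f (x + y) * \<kappa> y) \<le> B * \<bar>\<kappa> y\<bar>" for y
      using B[of "x + y"] by (simp add: abs_mult mult_right_mono)
  qed
  also have "\<dots> \<le> B * (2 * pi * L)"
    unfolding integral_mult_right by (rule mult_left_mono[OF L B0])
  finally show ?thesis by (simp add: circle_conv_def field_simps)
qed

lemma circle_conv_translates:
  assumes f: "cont_periodic f" and k: "continuous_on UNIV \<kappa>" and "finite I"
  shows "circle_conv \<kappa> (\<lambda>x. \<Sum>i\<in>I. a i * f (x + s i)) x = (\<Sum>i\<in>I. a i * circle_conv \<kappa> f (x + s i))"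
proof -
  have "integral {-pi..pi} (\<lambda>y. (\<Sum>i\<in>I. a i * f (x + y + s i)) * \<kappa> y)
      = integral {-pi..pi} (\<lambda>y. \<Sum>i\<in>I. a i * (f (x + s i + y) * \<kappa> y))"
    by (simp add: sum_distrib_right mult.assoc add_ac)
  also have "\<dots> = (\<Sum>i\<in>I. integral {-pi..pi} (\<lambda>y. a i * (f (x + s i + y) * \<kappa> y)))"
    by (intro integral_sum integrable_continuous_interval continuous_on_mult_left
        circle_conv_integrand_continuous assms)
  finally show ?thesis
    by (simp add: circle_conv_def sum_divide_distrib)
qed

lemma cos_coeff_translate:
  assumes f: "cont_periodic f"
  shows "cos_coeff j f (x + y) = cos (real j * y) * cos_coeff j f x
    + sin (real j * y) * integral {-pi..pi} (\<lambda>u. f (x + u) * sin (real j * u))"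
proof -
  note fI = cont_periodic_continuous_on[OF f]
  define h where "h u = f (x + u) * cos (real j * (u - y))" for u
  have h: "cont_periodic h"
  proof -
    have "f (x + (u + 2 * pi)) = f (x + u)" for u
      using f unfolding cont_periodic_def by (simp flip: add.assoc)
    moreover have "cos (real j * (u + 2 * pi - y)) = cos (real j * (u - y))" for u
    proof -
      have "real j * (u + 2 * pi - y) = real j * (u - y) + real j * 2 * pi"
        by (simp add: algebra_simps)
      then show ?thesis
        using cos.plus_of_nat[of "real j * (u - y)" j] by (simp add: mult.assoc)
    qed
    ultimately show ?thesis
      unfolding cont_periodic_def h_def by (auto intro!: continuous_intros fI)
  qed
  have "cos_coeff j f (x + y) = integral {-pi..pi} (\<lambda>z. h (y + z))"
    by (simp add: cos_coeff_def h_def add.assoc)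
  also have "\<dots> = integral {-pi..pi} h" by (rule integral_periodic_shift[OF h])
  also have "\<dots> = integral {-pi..pi} (\<lambda>u. cos (real j * y) * (f (x + u) * cos (real j * u))
      + sin (real j * y) * (f (x + u) * sin (real j * u)))"
    by (simp add: h_def[abs_def] right_diff_distrib cos_diff distrib_left mult_ac)
  also have "\<dots> = integral {-pi..pi} (\<lambda>u. cos (real j * y) * (f (x + u) * cos (real j * u)))
      + integral {-pi..pi} (\<lambda>u. sin (real j * y) * (f (x + u) * sin (real j * u)))"
    by (intro Henstock_Kurzweil_Integration.integral_add integrable_continuous_interval
        continuous_intros fI)
  finally show ?thesis by (simp add: cos_coeff_def)
qed

lemma integral_odd_eq_zero:
  fixes g :: "real \<Rightarrow> real"
  assumes "\<And>y. g (- y) = - g y"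
  shows "integral {-a..a} g = 0"
  using Henstock_Kurzweil_Integration.integral_reflect_real[of a "-a" g] assms by simp

text \<open>The sine term that a translation produces is lost against an even kernel, so convolution with an
  even kernel acts on every cosine coefficient as a scalar.\<close>
lemma cos_coeff_circle_conv:
  assumes f: "cont_periodic f" and k: "continuous_on UNIV \<kappa>" and even: "\<And>y. \<kappa> (- y) = \<kappa> y"
  shows "cos_coeff j (circle_conv \<kappa> f) x
    = cos_coeff j f x * integral {-pi..pi} (\<lambda>y. \<kappa> y * cos (real j * y)) / (2 * pi)"
proof -
  let ?B = "integral {-pi..pi} (\<lambda>u. f (x + u) * sin (real j * u))"
  have kI: "continuous_on S \<kappa>" for S using k continuous_on_subset by blast
  have "cos_coeff j (circle_conv \<kappa> f) x =
      integral (cbox (-pi) pi) (\<lambda>z. integral (cbox (-pi) pi)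
        (\<lambda>y. f (x + z + y) * \<kappa> y * cos (real j * z))) / (2 * pi)"
    by (simp add: cos_coeff_def circle_conv_def)
  also have "integral (cbox (-pi) pi) (\<lambda>z. integral (cbox (-pi) pi)
        (\<lambda>y. f (x + z + y) * \<kappa> y * cos (real j * z))) =
      integral (cbox (-pi) pi) (\<lambda>y. integral (cbox (-pi) pi)
        (\<lambda>z. f (x + z + y) * \<kappa> y * cos (real j * z)))"
    unfolding split_beta
    by (intro integral_swap_continuous)
      (auto simp: split_beta intro!: continuous_intros cont_periodic_continuous_on[OF f]
        continuous_on_compose2[OF k])
  also have "\<dots> = integral {-pi..pi} (\<lambda>y. \<kappa> y * cos_coeff j f (x + y))"
    by (simp add: cos_coeff_def mult_ac add_ac flip: integral_mult_right)
  also have "\<dots> = integral {-pi..pi} (\<lambda>y. cos_coeff j f x * (\<kappa> y * cos (real j * y))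
      + ?B * (\<kappa> y * sin (real j * y)))"
    by (simp add: cos_coeff_translate[OF f] distrib_left mult_ac)
  also have "\<dots> = integral {-pi..pi} (\<lambda>y. cos_coeff j f x * (\<kappa> y * cos (real j * y)))
      + integral {-pi..pi} (\<lambda>y. ?B * (\<kappa> y * sin (real j * y)))"
    by (intro Henstock_Kurzweil_Integration.integral_add integrable_continuous_interval
        continuous_intros kI)
  also have "integral {-pi..pi} (\<lambda>y. ?B * (\<kappa> y * sin (real j * y))) = 0"
    by (rule integral_odd_eq_zero) (simp add: even)
  finally show ?thesis by simp
qed

section \<open>Kernels adapted to high frequencies\<close>

text \<open>Multiplication by \<open>2 cos (n y)\<close> moves the even sequence \<open>q\<close> to the two centres \<open>n\<close> and \<open>-n\<close>. At a
  frequency \<open>l \<ge> n\<close> the two copies give \<open>q (l - n) + q (l + n)\<close>, and the second kernel takes away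
  the unwanted \<open>q (l + n)\<close>. Frequencies below \<open>n\<close> are invisible to functions orthogonal to
  trigonometric polynomials of degree less than \<open>n\<close>; letting the multiplier fall off on that side
  as it does on the other keeps the total mass bounded, however steep \<open>q\<close> is.\<close>
definition reflected_kernel :: "nat \<Rightarrow> (nat \<Rightarrow> real) \<Rightarrow> real \<Rightarrow> real" where
  "reflected_kernel n q y =
     2 * cos (real n * y) * cos_kernel q y - cos_kernel (\<lambda>j. q (j + n)) y"

lemma reflected_kernel_even: "reflected_kernel n q (- y) = reflected_kernel n q y"
  by (simp add: reflected_kernel_def cos_kernel_even)

context
  fixes q :: "nat \<Rightarrow> real" and n :: nat
  assumes q: "\<And>j. q j \<ge> 0" "summable q"
begin

lemma shifted_seq: "\<And>j. q (j + n) \<ge> 0" "summable (\<lambda>j. q (j + n))"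
  using q summable_iff_shift by blast+

lemma reflected_kernel_continuous: "continuous_on S (reflected_kernel n q)"
  unfolding reflected_kernel_def[abs_def]
  by (intro continuous_intros cos_kernel_continuous[OF q] cos_kernel_continuous[OF shifted_seq])

lemma reflected_kernel_coeff:
  assumes "l \<ge> n"
  shows "integral {-pi..pi} (\<lambda>y. reflected_kernel n q y * cos (real l * y)) = 2 * pi * q (l - n)"
proof -
  have "reflected_kernel n q y * cos (real l * y) =
      cos_kernel q y * cos (real (l - n) * y) + cos_kernel q y * cos (real (l + n) * y)
      - cos_kernel (\<lambda>j. q (j + n)) y * cos (real l * y)" for y
  proof -
    have "cos (real (l - n) * y) + cos (real (l + n) * y) = 2 * cos (real n * y) * cos (real l * y)"
      using assms by (simp add: of_nat_diff left_diff_distrib distrib_right cos_diff cos_add)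
    then have "cos_kernel q y * (cos (real (l - n) * y) + cos (real (l + n) * y)) =
        cos_kernel q y * (2 * cos (real n * y) * cos (real l * y))" by simp
    then show ?thesis
      unfolding reflected_kernel_def distrib_left left_diff_distrib by (simp add: mult_ac)
  qed
  then have "integral {-pi..pi} (\<lambda>y. reflected_kernel n q y * cos (real l * y)) =
      integral {-pi..pi} (\<lambda>y. cos_kernel q y * cos (real (l - n) * y))
      + integral {-pi..pi} (\<lambda>y. cos_kernel q y * cos (real (l + n) * y))
      - integral {-pi..pi} (\<lambda>y. cos_kernel (\<lambda>j. q (j + n)) y * cos (real l * y))"
    by (simp add: Henstock_Kurzweil_Integration.integral_add
        Henstock_Kurzweil_Integration.integral_diff integrable_continuous_interval integrable_add
        continuous_on_mult continuous_intros
        cos_kernel_continuous[OF q] cos_kernel_continuous[OF shifted_seq])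
  then show ?thesis
    by (simp only: cos_kernel_coeff[OF q] cos_kernel_coeff[OF shifted_seq])
qed

text \<open>Convexity makes both cosine kernels nonnegative, so their masses are their zeroth coefficients.\<close>
lemma reflected_kernel_L1:
  assumes convex: "\<And>j. 2 * q (Suc j) \<le> q j + q (Suc (Suc j))" and "q n \<le> q 0"
  shows "integral {-pi..pi} (\<lambda>y. \<bar>reflected_kernel n q y\<bar>) \<le> 2 * pi * (3 * q 0)"
proof -
  let ?r = "\<lambda>j. q (j + n)"
  have nn: "cos_kernel q y \<ge> 0" "cos_kernel ?r y \<ge> 0" for y
    using cos_kernel_nonneg[OF q convex] cos_kernel_nonneg[OF shifted_seq] convex by simp_all
  have "integral {-pi..pi} (\<lambda>y. \<bar>reflected_kernel n q y\<bar>)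
      \<le> integral {-pi..pi} (\<lambda>y. 2 * cos_kernel q y + cos_kernel ?r y)"
  proof (intro integral_le integrable_continuous_interval continuous_intros
      reflected_kernel_continuous cos_kernel_continuous q shifted_seq)
    fix y
    have "\<bar>cos (real n * y)\<bar> * cos_kernel q y \<le> 1 * cos_kernel q y"
      by (intro mult_right_mono nn) simp
    then show "\<bar>reflected_kernel n q y\<bar> \<le> 2 * cos_kernel q y + cos_kernel ?r y"
      using nn[of y] abs_triangle_ineq4[of "2 * cos (real n * y) * cos_kernel q y" "cos_kernel ?r y"]
      by (simp add: reflected_kernel_def abs_mult)
  qed
  also have "\<dots> = 2 * integral {-pi..pi} (cos_kernel q) + integral {-pi..pi} (cos_kernel ?r)"
    by (subst Henstock_Kurzweil_Integration.integral_add)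
      (auto intro!: integrable_continuous_interval continuous_intros
      cos_kernel_continuous q shifted_seq)
  also have "\<dots> = 2 * (2 * pi * q 0) + 2 * pi * q n"
    using cos_kernel_coeff[OF q, of 0] cos_kernel_coeff[OF shifted_seq, of 0] by simp
  also have "\<dots> \<le> 2 * pi * (3 * q 0)"
    using \<open>q n \<le> q 0\<close> by (simp add: algebra_simps)
  finally show ?thesis .
qed

end

text \<open>Placed at the centre \<open>n\<close>, this is the multiplier \<open>(n / l) ^ (2 m)\<close> at the frequency \<open>l = n + j\<close>.\<close>
definition power_seq :: "nat \<Rightarrow> nat \<Rightarrow> nat \<Rightarrow> real" where
  "power_seq n m j = (real n / real (n + j)) ^ (2 * m)"

lemma power_seq_nonneg: "power_seq n m j \<ge> 0"
  by (simp add: power_seq_def)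

lemma power_seq_le_one: "power_seq n m j \<le> 1"
  unfolding power_seq_def by (rule power_le_one) (auto simp: divide_simps)

lemma power_seq_summable:
  assumes "m \<ge> 1"
  shows "summable (power_seq n m)"
proof (rule summable_comparison_test')
  show "summable (\<lambda>j. (real n)\<^sup>2 * (1 / (real j)\<^sup>2))"
    by (rule summable_mult) (use inverse_power_summable[of 2] in \<open>simp add: inverse_eq_divide\<close>)
  fix j :: nat assume j: "j \<ge> 1"
  have "power_seq n m j \<le> (real n / real (n + j)) ^ 2"
    unfolding power_seq_def by (rule power_decreasing) (use assms in \<open>auto simp: divide_simps\<close>)
  also have "\<dots> \<le> (real n / real j) ^ 2"
    by (intro power_mono divide_left_mono) (use j in auto)
  finally show "norm (power_seq n m j) \<le> (real n)\<^sup>2 * (1 / (real j)\<^sup>2)"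
    using power_seq_nonneg[of n m j] by (simp add: power_divide)
qed

text \<open>By the inequality between arithmetic and geometric means, since
  \<open>(n + j) (n + j + 2) \<le> (n + j + 1)\<^sup>2\<close>.\<close>
lemma power_seq_convex:
  assumes "n \<ge> 1"
  shows "2 * power_seq n m (Suc j) \<le> power_seq n m j + power_seq n m (Suc (Suc j))"
proof -
  define a b c where "a = real n / real (n + j)" and "b = real n / real (n + Suc (Suc j))"
    and "c = real n / real (n + Suc j)"
  define N where "N = real (n + j)"
  have N: "N > 0" using assms by (simp add: N_def)
  have "(N * (N + 2)) \<le> (N + 1)\<^sup>2" by (simp add: power2_eq_square algebra_simps)
  then have "(real n)\<^sup>2 / (N + 1)\<^sup>2 \<le> (real n)\<^sup>2 / (N * (N + 2))"
    using N by (intro divide_left_mono) auto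
  moreover have "c\<^sup>2 = (real n)\<^sup>2 / (N + 1)\<^sup>2" "a * b = (real n)\<^sup>2 / (N * (N + 2))"
    by (simp_all add: a_def b_def c_def N_def power_divide power2_eq_square add_ac)
  ultimately have "c\<^sup>2 \<le> a * b" by simp
  then have "(c\<^sup>2) ^ m \<le> (a * b) ^ m" by (rule power_mono) simp
  also have "2 * (a * b) ^ m \<le> (a ^ m)\<^sup>2 + (b ^ m)\<^sup>2"
    using sum_squares_bound[of "a ^ m" "b ^ m"] by (simp add: power_mult_distrib)
  finally show ?thesis
    by (simp add: power_seq_def a_def b_def c_def power_mult flip: power_mult mult.commute[of 2 m])
qed

section \<open>Iterated double integration of functions without low frequencies\<close>

text \<open>On functions orthogonal to trigonometric polynomials of degree less than \<open>n\<close> this is the \<open>m\<close>-th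
  power of \<open>- n\<^sup>2\<close> times double integration. It is defined by a kernel because
  the norm can be read off from a kernel.\<close>
definition inverse_power_op :: "nat \<Rightarrow> nat \<Rightarrow> (real \<Rightarrow> real) \<Rightarrow> real \<Rightarrow> real" where
  "inverse_power_op n m f =
     (if m = 0 then f else circle_conv (reflected_kernel n (power_seq n m)) f)"

lemma power_kernel_continuous:
  "m \<ge> 1 \<Longrightarrow> continuous_on S (reflected_kernel n (power_seq n m))"
  by (rule reflected_kernel_continuous[OF power_seq_nonneg power_seq_summable])

lemma inverse_power_op_cont_periodic:
  assumes "cont_periodic f"
  shows "cont_periodic (inverse_power_op n m f)"
  using assms circle_conv_cont_periodic[OF assms power_kernel_continuous]
  by (simp add: inverse_power_op_def)

text \<open>This is an inequality of Bohr--Favard type. That the constant does not depend on \<open>m\<close> is essential: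
  iterating a bound for \<open>m = 1\<close> would give one that grows exponentially in \<open>m\<close>.\<close>
lemma inverse_power_op_bound:
  assumes f: "cont_periodic f" and n: "n \<ge> 1" and B: "\<And>x. \<bar>f x\<bar> \<le> B"
  shows "\<bar>inverse_power_op n m f x\<bar> \<le> 3 * B"
proof (cases "m = 0")
  case True
  have "0 \<le> \<bar>f x\<bar>" by simp
  then have "\<bar>f x\<bar> \<le> 3 * B" using B[of x] by linarith
  then show ?thesis using True by (simp add: inverse_power_op_def)
next
  case False
  then have m: "m \<ge> 1" by simp
  have q0: "power_seq n m 0 = 1" using n by (simp add: power_seq_def)
  have "integral {-pi..pi} (\<lambda>y. \<bar>reflected_kernel n (power_seq n m) y\<bar>) \<le> 2 * pi * 3"
    using reflected_kernel_L1[OF power_seq_nonneg power_seq_summable[OF m] power_seq_convex[OF n],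
        of n] power_seq_le_one[of n m n]
    by (simp add: q0)
  from circle_conv_bound[OF f power_kernel_continuous[OF m] this B] show ?thesis
    using False by (simp add: inverse_power_op_def)
qed

lemma inverse_power_op_translates:
  assumes "cont_periodic f" "finite I"
  shows "inverse_power_op n m (\<lambda>x. \<Sum>i\<in>I. a i * f (x + s i)) x
    = (\<Sum>i\<in>I. a i * inverse_power_op n m f (x + s i))"
  using circle_conv_translates[OF assms(1) power_kernel_continuous assms(2)]
  by (simp add: inverse_power_op_def)

lemma cos_coeff_inverse_power_op:
  assumes f: "cont_periodic f" and n: "n \<ge> 1" and j: "j \<ge> n"
  shows "cos_coeff j (inverse_power_op n m f) x = (real n / real j) ^ (2 * m) * cos_coeff j f x"
proof (cases "m = 0")
  case True
  then show ?thesis by (simp add: inverse_power_op_def)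
next
  case False
  then have m: "m \<ge> 1" by simp
  have "cos_coeff j (inverse_power_op n m f) x = cos_coeff j f x * power_seq n m (j - n)"
    using False reflected_kernel_coeff[OF power_seq_nonneg power_seq_summable[OF m] j]
      cos_coeff_circle_conv[OF f power_kernel_continuous[OF m] reflected_kernel_even]
    by (simp add: inverse_power_op_def)
  then show ?thesis using j by (simp add: power_seq_def)
qed

lemma cos_coeff_trig_perp:
  assumes f: "f \<in> trig_perp (n - 1)" and j: "j < n"
  shows "cos_coeff j f x = 0"
proof -
  have per: "cont_periodic f" using f by (simp add: trig_perp_def)
  have zero: "integral {-pi..pi} (\<lambda>x. f x * \<tau> x) = 0" if "trig_poly (n - 1) \<tau>" for \<tau>
    using f that by (simp add: trig_perp_def)
  have "trig_poly (n - 1) (\<lambda>u. cos (real j * u))"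
    unfolding trig_poly_def
  proof (intro exI allI)
    fix x
    show "cos (real j * x) = (\<lambda>i. if i = j then 1 else 0) 0
      + (\<Sum>i=1..n - 1. (\<lambda>i. if i = j then 1 else 0) i * cos (real i * x) + (\<lambda>_. 0) i * sin (real i * x))"
      using j by (cases "j = 0") (auto simp: if_distrib[of "\<lambda>c. c * _"] cong: if_cong)
  qed
  from zero[OF this] have c: "integral {-pi..pi} (\<lambda>u. f u * cos (real j * u)) = 0" .
  have "trig_poly (n - 1) (\<lambda>u. sin (real j * u))"
    unfolding trig_poly_def
  proof (intro exI allI)
    fix x
    show "sin (real j * x) = (\<lambda>_. 0) (0::nat)
      + (\<Sum>i=1..n - 1. (\<lambda>_. 0) i * cos (real i * x) + (\<lambda>i. if i = j then 1 else 0) i * sin (real i * x))"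
      using j by (cases "j = 0") (auto simp: if_distrib[of "\<lambda>c. c * _"] cong: if_cong)
  qed
  from zero[OF this] have s: "integral {-pi..pi} (\<lambda>u. f u * sin (real j * u)) = 0" .
  show ?thesis
    using cos_coeff_translate[OF per, of j 0 x] c s by (simp add: cos_coeff_def)
qed

lemma cos_coeff_inverse_power_op_perp:
  assumes f: "f \<in> trig_perp (n - 1)" and j: "j < n"
  shows "cos_coeff j (inverse_power_op n m f) x = 0"
proof (cases "m = 0")
  case True
  then show ?thesis using cos_coeff_trig_perp[OF assms] by (simp add: inverse_power_op_def)
next
  case False
  then have m: "m \<ge> 1" by simp
  have "cont_periodic f" using f by (simp add: trig_perp_def)
  then show ?thesis
    using False cos_coeff_circle_conv[OF _ power_kernel_continuous[OF m] reflected_kernel_even]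
      cos_coeff_trig_perp[OF assms]
    by (simp add: inverse_power_op_def)
qed

text \<open>Two integrations by parts, done at once: the boundary terms cancel by periodicity.\<close>
lemma cos_coeff_second_derivative:
  assumes P: "cont_periodic P" and P1: "cont_periodic P1" and g: "cont_periodic g"
    and d: "\<And>x. (P has_real_derivative P1 x) (at x)" "\<And>x. (P1 has_real_derivative g x) (at x)"
  shows "cos_coeff j g x = - (real j)\<^sup>2 * cos_coeff j P x"
proof -
  let ?F = "\<lambda>y. P1 (x + y) * cos (real j * y) + real j * P (x + y) * sin (real j * y)"
  have D: "(?F has_real_derivative g (x + y) * cos (real j * y) + (real j)\<^sup>2 * (P (x + y) * cos (real j * y)))
      (at y)" for y
    using DERIV_affine[OF d(1), of x 1] DERIV_affine[OF d(2), of x 1]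
    by (auto intro!: derivative_eq_intros simp: power2_eq_square algebra_simps)
  have per: "h (x + pi) = h (x - pi)" if "cont_periodic h" for h
    using that unfolding cont_periodic_def by (metis add.commute diff_add_cancel add_diff_eq mult_2 add.assoc)
  have "((\<lambda>y. g (x + y) * cos (real j * y) + (real j)\<^sup>2 * (P (x + y) * cos (real j * y)))
      has_integral (?F pi - ?F (- pi))) {-pi..pi}"
    by (rule has_integral_antiderivative[OF _ D]) simp
  moreover have "?F pi - ?F (- pi) = 0"
    using per[OF P1] per[OF P] by (simp add: mult.commute)
  ultimately have "integral {-pi..pi} (\<lambda>y. g (x + y) * cos (real j * y) + (real j)\<^sup>2 * (P (x + y) * cos (real j * y))) = 0"
    by (simp add: integral_unique)
  also have "integral {-pi..pi} (\<lambda>y. g (x + y) * cos (real j * y) + (real j)\<^sup>2 * (P (x + y) * cos (real j * y)))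
      = integral {-pi..pi} (\<lambda>y. g (x + y) * cos (real j * y))
        + integral {-pi..pi} (\<lambda>y. (real j)\<^sup>2 * (P (x + y) * cos (real j * y)))"
    by (intro Henstock_Kurzweil_Integration.integral_add integrable_continuous_interval
        continuous_intros cont_periodic_continuous_on[OF g] cont_periodic_continuous_on[OF P])
  finally show ?thesis by (simp add: cos_coeff_def)
qed

text \<open>The double antiderivative of the \<open>m\<close>-th function, times \<open>- n\<^sup>2\<close>, has the cosine coefficients of the
  next one, so the two agree.\<close>
lemma inverse_power_op_derivatives:
  assumes f: "f \<in> trig_perp (n - 1)" and n: "n \<ge> 1"
  obtains E1 where "\<And>x. (inverse_power_op n (Suc m) f has_real_derivative E1 x) (at x)"
    "\<And>x. (E1 has_real_derivative - (real n)\<^sup>2 * inverse_power_op n m f x) (at x)"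
proof -
  let ?g = "inverse_power_op n m f" and ?E = "inverse_power_op n (Suc m) f"
  have per: "cont_periodic f" using f by (simp add: trig_perp_def)
  have g: "cont_periodic ?g" and E: "cont_periodic ?E"
    using inverse_power_op_cont_periodic[OF per] by blast+
  have "integral {-pi..pi} ?g = 0"
    using cos_coeff_inverse_power_op_perp[OF f, of 0 m 0] n by (simp add: cos_coeff_def)
  then obtain P1 where P1: "cont_periodic P1" "integral {-pi..pi} P1 = 0"
      "\<And>x. (P1 has_real_derivative ?g x) (at x)"
    using periodic_antiderivative[OF g] by blast
  obtain P where P: "cont_periodic P" "integral {-pi..pi} P = 0"
      "\<And>x. (P has_real_derivative P1 x) (at x)"
    using periodic_antiderivative[OF P1(1,2)] by blast
  let ?h = "\<lambda>x. ?E x + (real n)\<^sup>2 * P x"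
  have "?h x = 0" for x
  proof (rule cos_coeff_unique[of ?h])
    show "cont_periodic ?h"
      using E P(1) by (auto simp: cont_periodic_def intro!: continuous_intros)
    fix j
    have lin: "cos_coeff j ?h x = cos_coeff j ?E x + (real n)\<^sup>2 * cos_coeff j P x"
    proof -
      have "integral {-pi..pi} (\<lambda>y. ?h (x + y) * cos (real j * y)) =
        integral {-pi..pi} (\<lambda>y. ?E (x + y) * cos (real j * y) + (real n)\<^sup>2 * (P (x + y) * cos (real j * y)))"
        by (simp add: distrib_right mult.assoc)
      also have "\<dots> = integral {-pi..pi} (\<lambda>y. ?E (x + y) * cos (real j * y))
          + integral {-pi..pi} (\<lambda>y. (real n)\<^sup>2 * (P (x + y) * cos (real j * y)))"
        by (intro Henstock_Kurzweil_Integration.integral_add integrable_continuous_interval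
          continuous_intros cont_periodic_continuous_on[OF E] cont_periodic_continuous_on[OF P(1)])
      finally show ?thesis by (simp add: cos_coeff_def)
    qed
    have gP: "cos_coeff j ?g x = - (real j)\<^sup>2 * cos_coeff j P x"
      by (rule cos_coeff_second_derivative[OF P(1) P1(1) g P(3) P1(3)])
    show "cos_coeff j ?h x = 0"
    proof (cases "j < n")
      case True
      have "cos_coeff j P x = 0"
      proof (cases "j = 0")
        case True
        then show ?thesis
          using integral_periodic_shift[OF P(1), of x] P(2) by (simp add: cos_coeff_def)
      next
        case False
        then show ?thesis
          using gP cos_coeff_inverse_power_op_perp[OF f \<open>j < n\<close>] by simp
      qed
      then show ?thesis
        using lin cos_coeff_inverse_power_op_perp[OF f \<open>j < n\<close>] by simp
    next
      case False
      then have j: "j \<ge> n" "real j > 0" using n by auto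
      let ?A = "cos_coeff j f x"
      have "(real j)\<^sup>2 * cos_coeff j P x = - ((real n / real j) ^ (2 * m) * ?A)"
        using gP cos_coeff_inverse_power_op[OF per n j(1), of m x] by linarith
      then have "cos_coeff j P x = - ((real n / real j) ^ (2 * m) * ?A) / (real j)\<^sup>2"
        using j(2) by (simp add: field_simps)
      moreover have "cos_coeff j ?E x = (real n / real j)\<^sup>2 * ((real n / real j) ^ (2 * m) * ?A)"
        using cos_coeff_inverse_power_op[OF per n j(1), of "Suc m" x]
        by (simp add: power2_eq_square mult.assoc)
      ultimately show ?thesis
        using lin by (simp add: power_divide)
    qed
  qed
  then have EP: "?E = (\<lambda>x. - (real n)\<^sup>2 * P x)" by (simp add: fun_eq_iff eq_neg_iff_add_eq_0)
  show thesis
  proof (rule that[of "\<lambda>x. - (real n)\<^sup>2 * P1 x"])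
    show "(?E has_real_derivative - (real n)\<^sup>2 * P1 x) (at x)" for x
      unfolding EP by (rule DERIV_cmult[OF P(3)])
    show "((\<lambda>x. - (real n)\<^sup>2 * P1 x) has_real_derivative - (real n)\<^sup>2 * ?g x) (at x)" for x
      by (rule DERIV_cmult[OF P1(3)])
  qed
qed

text \<open>Integration against the triangular weight \<open>h - t\<close> undoes two derivatives and leaves a second
  difference.\<close>
lemma weighted_symmetric_mean:
  assumes d1: "\<And>x. (E has_real_derivative E1 x) (at x)"
    and d2: "\<And>x. (E1 has_real_derivative - c * g x) (at x)"
    and "c \<noteq> 0" "s \<noteq> 0" "h \<ge> 0"
  shows "((\<lambda>t. (h - t) * (g (x + s * t) + g (x - s * t))) has_integral
    - (E (x + s * h) - 2 * E x + E (x - s * h)) / (c * s\<^sup>2)) {0..h}"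
proof -
  define a e where "a = 1 / s" and "e = - 1 / c"
  let ?F = "\<lambda>t. e * (a * ((h - t) * (E1 (x + s * t) - E1 (x + (- s) * t)))
    + a\<^sup>2 * (E (x + s * t) + E (x + (- s) * t)))"
  have ae: "a * s = 1" "e * c = - 1" using assms(3,4) by (simp_all add: a_def e_def)
  have D: "(?F has_real_derivative (h - t) * (g (x + s * t) + g (x - s * t))) (at t)" for t
  proof -
    have "(?F has_real_derivative e * (a * ((h - t) * (- c * g (x + s * t) * s - - c * g (x + (- s) * t) * - s)
        + (0 - 1) * (E1 (x + s * t) - E1 (x + (- s) * t))) + a\<^sup>2 * (E1 (x + s * t) * s + E1 (x + (- s) * t) * - s))) (at t)"
      by (intro DERIV_cmult DERIV_add DERIV_mult' DERIV_diff DERIV_affine[OF d1] DERIV_affine[OF d2]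
          DERIV_const DERIV_ident)
    also have "e * (a * ((h - t) * (- c * g (x + s * t) * s - - c * g (x + (- s) * t) * - s)
        + (0 - 1) * (E1 (x + s * t) - E1 (x + (- s) * t))) + a\<^sup>2 * (E1 (x + s * t) * s + E1 (x + (- s) * t) * - s))
        = - (e * c) * (a * s) * (h - t) * (g (x + s * t) + g (x - s * t))
          + e * a * (a * s - 1) * (E1 (x + s * t) - E1 (x - s * t))"
      by (simp add: algebra_simps power2_eq_square)
    finally show ?thesis by (simp add: ae)
  qed
  have "((\<lambda>t. (h - t) * (g (x + s * t) + g (x - s * t))) has_integral (?F h - ?F 0)) {0..h}"
    by (rule has_integral_antiderivative[OF \<open>h \<ge> 0\<close> D])
  moreover have "?F h - ?F 0 = - (E (x + s * h) - 2 * E x + E (x - s * h)) / (c * s\<^sup>2)"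
    using assms(3,4) by (simp add: a_def e_def field_simps)
  ultimately show ?thesis by simp
qed

section \<open>Central differences\<close>

text \<open>The coefficient of \<open>g (x \<plusminus> i t)\<close> in the central difference of order \<open>2 k\<close>, up to sign, when that
  of \<open>g x\<close> is scaled to 1.\<close>
definition central_ratio :: "nat \<Rightarrow> nat \<Rightarrow> real" where
  "central_ratio k i = real ((2 * k) choose (k + i)) / real ((2 * k) choose k)"

lemma central_binomial_pos: "real ((2 * k) choose k) > 0"
  by (simp add: zero_less_binomial_iff)

lemma central_ratio_nonneg: "central_ratio k i \<ge> 0"
  by (simp add: central_ratio_def)

lemma central_ratio_0: "central_ratio k 0 = 1"
  using central_binomial_pos[of k] by (simp add: central_ratio_def)

lemma central_ratio_Suc:
  assumes "i \<le> k"
  shows "central_ratio k (Suc i) = central_ratio k i * ((real k - real i) / (real k + real i + 1))"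
proof -
  have "2 * k - (k + i) = k - i" by simp
  then have absorb: "Suc (k + i) * ((2 * k) choose Suc (k + i)) = ((2 * k) choose (k + i)) * (k - i)"
    using binomial_absorb_comp[of "2 * k" "k + i"] binomial_absorption[of "k + i" "2 * k"]
    by (simp only: mult.commute)
  have "real (Suc (k + i)) * real ((2 * k) choose Suc (k + i))
      = real ((2 * k) choose (k + i)) * real (k - i)"
    using absorb by (simp only: of_nat_mult[symmetric])
  then have "real ((2 * k) choose Suc (k + i))
      = real ((2 * k) choose (k + i)) * ((real k - real i) / (real k + real i + 1))"
    using assms by (simp add: of_nat_diff field_simps)
  then show ?thesis by (simp add: central_ratio_def)
qed

lemma central_ratio_decreasing:
  assumes "i \<le> k"
  shows "central_ratio k (Suc i) \<le> central_ratio k i"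
proof -
  have "(real k - real i) / (real k + real i + 1) \<le> 1" by simp
  from mult_left_mono[OF this central_ratio_nonneg[of k i]] show ?thesis
    by (simp add: central_ratio_Suc[OF assms])
qed

text \<open>The ratio behaves like \<open>exp (- i\<^sup>2 / k)\<close>. This rational bound suffices and fits an induction: the
  terms in which \<open>k\<close> occurs cancel in the step.\<close>
lemma central_ratio_le:
  assumes "k \<ge> 1" "i \<le> k"
  shows "central_ratio k i \<le> real k / (real k + (real i)\<^sup>2)"
  using assms(2)
proof (induction i)
  case 0
  then show ?case using assms(1) by (simp add: central_ratio_0)
next
  case (Suc i)
  define K I where "K = real k" and "I = real i"
  have K: "K > 0" "I \<ge> 0" "I \<le> K" using assms(1) Suc.prems by (auto simp: K_def I_def)
  have pos: "K + I\<^sup>2 > 0" "K + I + 1 > 0" "K + (I + 1)\<^sup>2 > 0"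
    using K by (auto intro: add_pos_nonneg)
  have "central_ratio k (Suc i) = central_ratio k i * ((K - I) / (K + I + 1))"
    using central_ratio_Suc[of i k] Suc.prems by (simp add: K_def I_def)
  also have "\<dots> \<le> K / (K + I\<^sup>2) * ((K - I) / (K + I + 1))"
    using Suc K pos by (intro mult_right_mono) (auto simp: K_def I_def)
  also have "\<dots> \<le> K / (K + (I + 1)\<^sup>2)"
  proof -
    have "(K + I\<^sup>2) * (K + I + 1) - (K - I) * (K + (I + 1)\<^sup>2) = I\<^sup>2 * (I + 1) + I * (I + 1)\<^sup>2"
      by (simp add: algebra_simps power2_eq_square)
    also have "\<dots> \<ge> 0" using K by simp
    finally have "(K - I) * (K + (I + 1)\<^sup>2) \<le> (K + I\<^sup>2) * (K + I + 1)" by linarith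
    then have "(K - I) / ((K + I\<^sup>2) * (K + I + 1)) \<le> 1 / (K + (I + 1)\<^sup>2)"
      using pos by (simp add: divide_simps mult_pos_pos split: if_splits)
    from mult_left_mono[OF this, of K] K show ?thesis by simp
  qed
  finally show ?case by (simp add: K_def I_def add.commute)
qed

lemma fin_diff_central:
  "fin_diff (2 * k) t g (x - real k * t) = (-1) ^ k * real ((2 * k) choose k) *
    (g x + (\<Sum>i=1..k. (-1) ^ i * central_ratio k i * (g (x + real i * t) + g (x - real i * t))))"
proof -
  let ?C = "real ((2 * k) choose k)"
  let ?T = "\<lambda>l. (-1) ^ l * real ((2 * k) choose l) * g (x - real k * t + real l * t)"
  have up: "?T (k + i) = (-1) ^ k * ?C * ((-1) ^ i * central_ratio k i * g (x + real i * t))" for i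
    using central_binomial_pos[of k]
    by (simp add: central_ratio_def power_add distrib_right)
  have down: "?T (k - i) = (-1) ^ k * ?C * ((-1) ^ i * central_ratio k i * g (x - real i * t))"
    if "i \<le> k" for i
  proof -
    have e1: "(-1::real) ^ (k - i) = (-1) ^ k * (-1) ^ i"
      using that by (simp add: minus_one_power_iff)
    have e2: "(2 * k) choose (k - i) = (2 * k) choose (k + i)"
      using binomial_symmetric[of "k - i" "2 * k"] that by (simp add: algebra_simps)
    have e3: "x - real k * t + real (k - i) * t = x - real i * t"
      using that by (simp add: of_nat_diff left_diff_distrib)
    show ?thesis
      unfolding e1 e2 e3 using central_binomial_pos[of k] by (simp add: central_ratio_def)
  qed
  have "{0..2 * k} = insert k ({..<k} \<union> {k + 1..k + k})" by auto
  then have "fin_diff (2 * k) t g (x - real k * t) = ?T k + sum ?T ({..<k} \<union> {k + 1..k + k})"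
    by (simp add: fin_diff_def)
  also have "sum ?T ({..<k} \<union> {k + 1..k + k}) = sum ?T {..<k} + sum ?T {k + 1..k + k}"
    by (rule sum.union_disjoint) auto
  also have "sum ?T {..<k} = (\<Sum>i=1..k. ?T (k - i))"
    by (rule sum.reindex_bij_witness[of _ "\<lambda>i. k - i" "\<lambda>i. k - i"]) auto
  also have "\<dots> = (\<Sum>i=1..k. (-1) ^ k * ?C * ((-1) ^ i * central_ratio k i * g (x - real i * t)))"
    by (rule sum.cong[OF refl down]) auto
  also have "sum ?T {k + 1..k + k} = (\<Sum>i=1..k. ?T (k + i))"
    by (rule sum.reindex_bij_witness[of _ "\<lambda>i. k + i" "\<lambda>i. i - k"]) auto
  also have "\<dots> = (\<Sum>i=1..k. (-1) ^ k * ?C * ((-1) ^ i * central_ratio k i * g (x + real i * t)))"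
    by (rule sum.cong[OF refl up])
  also have "?T k = (-1) ^ k * ?C * g x" by simp
  finally show ?thesis
    by (simp only: distrib_left sum.distrib sum_distrib_left mult.assoc)
qed

lemma alternating_sum_nonneg:
  fixes b :: "nat \<Rightarrow> real"
  assumes "\<And>i. i \<ge> 1 \<Longrightarrow> i \<le> k \<Longrightarrow> b i \<ge> 0" "\<And>i. i \<ge> 1 \<Longrightarrow> i < k \<Longrightarrow> b (Suc i) \<le> b i"
  shows "(\<Sum>i=1..k. (-1) ^ Suc i * b i) \<ge> 0"
proof -
  \<comment> \<open>A partial sum that ends with a positive term still has room for the next, smaller, negative one.\<close>
  have "(if odd j then b j else 0) \<le> (\<Sum>i=1..j. (-1) ^ Suc i * b i)" if "j \<le> k" for j
    using that
  proof (induction j)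
    case (Suc j)
    then have IH: "(if odd j then b j else 0) \<le> (\<Sum>i=1..j. (-1) ^ Suc i * b i)" by simp
    show ?case
    proof (cases "odd j")
      case True
      then have "j \<ge> 1" by presburger
      then show ?thesis using True IH Suc.prems assms(2)[of j] by simp
    next
      case False
      then show ?thesis using IH by simp
    qed
  qed simp
  from this[of k] assms(1)[of k] show ?thesis
    by (cases "odd k") (auto intro: order_trans elim: oddE)
qed

text \<open>The sum of all terms and the alternating sum add up to twice the sum over the odd indices.\<close>
lemma alternating_plus_sum:
  fixes b :: "nat \<Rightarrow> real"
  shows "(\<Sum>i=1..k. b i) + (\<Sum>i=1..k. (-1) ^ Suc i * b i) = 2 * (\<Sum>j<(k + 1) div 2. b (2 * j + 1))"
proof (induction k)
  case (Suc k)
  show ?case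
  proof (cases "even k")
    case True
    then have "(Suc k + 1) div 2 = Suc ((k + 1) div 2)" "2 * ((k + 1) div 2) + 1 = Suc k"
      by presburger+
    then show ?thesis using Suc True by simp
  next
    case False
    then have "(Suc k + 1) div 2 = (k + 1) div 2" by presburger
    then show ?thesis using Suc False by simp
  qed
qed simp

text \<open>The odd part of \<open>\<Sum> 1 / i\<^sup>2 = \<pi>\<^sup>2 / 6\<close> is three quarters of it.\<close>
lemma sum_odd_squares_le: "(\<Sum>j<N. 1 / (real (2 * j + 1))\<^sup>2) \<le> pi\<^sup>2 / 8"
proof -
  let ?f = "\<lambda>n::nat. 1 / (real (n + 1))\<^sup>2"
  have f: "?f sums (pi\<^sup>2 / 6)" using inverse_squares_sums by (simp add: add.commute)
  have "(\<lambda>n. (\<Sum>i<2 * n. ?f i) - 1 / 4 * (\<Sum>i<n. ?f i)) \<longlonglongrightarrow> pi\<^sup>2 / 6 - 1 / 4 * (pi\<^sup>2 / 6)"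
  proof (intro tendsto_diff tendsto_mult_left)
    show "(\<lambda>n. \<Sum>i<n. ?f i) \<longlonglongrightarrow> pi\<^sup>2 / 6" using f by (simp add: sums_def)
    then show "(\<lambda>n. \<Sum>i<2 * n. ?f i) \<longlonglongrightarrow> pi\<^sup>2 / 6"
      by (rule filterlim_compose) (auto intro!: filterlim_subseq strict_monoI)
  qed
  moreover have "(\<Sum>i<2 * n. ?f i) - 1 / 4 * (\<Sum>i<n. ?f i) = (\<Sum>j<n. 1 / (real (2 * j + 1))\<^sup>2)" for n
  proof (induction n)
    case (Suc n)
    have "(\<Sum>i<2 * Suc n. ?f i) = (\<Sum>i<2 * n. ?f i) + 1 / (real (2 * n + 1))\<^sup>2 + 1 / (real (2 * n + 2))\<^sup>2"
      by (simp add: add.commute)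
    moreover have "1 / (real (2 * n + 2))\<^sup>2 = 1 / 4 * ?f n"
    proof -
      have "real (2 * n + 2) = 2 * real (n + 1)" by simp
      then show ?thesis by (simp only: power_mult_distrib) simp
    qed
    moreover have "A' - 1 / 4 * (S + r) = T + p"
      if "A' = A + p + q" "q = 1 / 4 * r" "A - 1 / 4 * S = T" for A A' S T p q r :: real
      using that by (simp add: field_simps)
    ultimately show ?case unfolding sum.lessThan_Suc[of _ n] using Suc.IH by blast
  qed simp
  ultimately have "(\<lambda>n. \<Sum>j<n. 1 / (real (2 * j + 1))\<^sup>2) \<longlonglongrightarrow> pi\<^sup>2 / 8" by simp
  then show ?thesis
    by (rule incseq_le[rotated]) (auto intro!: incseq_SucI)
qed

text \<open>The bound on the ratios turns each summand into \<open>1 / i\<^sup>2 - 1 / (k + i\<^sup>2)\<close>. The subtracted terms are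
  at least \<open>1 / (2 k)\<close> for the roughly \<open>sqrt k / 2\<close> odd \<open>i\<close> up to \<open>sqrt k\<close>. This gap of order
  \<open>1 / sqrt k\<close> is what produces the factor \<open>sqrt k\<close> in the final constant.\<close>
lemma odd_central_sum_le:
  assumes k: "k \<ge> 1"
  shows "(\<Sum>j<(k + 1) div 2. central_ratio k (2 * j + 1) / (real (2 * j + 1))\<^sup>2)
    \<le> pi\<^sup>2 / 8 - 1 / (8 * sqrt (real k))"
proof -
  let ?N = "(k + 1) div 2"
  define s where "s = nat \<lfloor>sqrt (real k)\<rfloor>"
  define r where "r = (s + 1) div 2"
  have sq1: "sqrt (real k) \<ge> 1" using k by simp
  have s: "real s \<le> sqrt (real k)" "sqrt (real k) < real s + 1"
    using sq1 by (auto simp: s_def)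
  have s2: "s\<^sup>2 \<le> k"
  proof -
    have "(real s)\<^sup>2 \<le> (sqrt (real k))\<^sup>2" by (rule power_mono[OF s(1)]) simp
    then show ?thesis by (simp flip: of_nat_power)
  qed
  have "s \<le> s\<^sup>2" by (simp add: power2_eq_square)
  then have "s \<le> k" using s2 by linarith
  then have rN: "r \<le> ?N" unfolding r_def by (intro div_le_mono) simp
  have r: "real r \<ge> sqrt (real k) / 4"
  proof -
    have "s \<ge> 1" using s(2) sq1 by linarith
    moreover have "2 * r \<ge> s" unfolding r_def by presburger
    ultimately have "real s \<ge> 1" "2 * real r \<ge> real s" by linarith+
    then show ?thesis using s(2) by linarith
  qed
  have summand: "central_ratio k (2 * j + 1) / (real (2 * j + 1))\<^sup>2
      \<le> 1 / (real (2 * j + 1))\<^sup>2 - 1 / (real k + (real (2 * j + 1))\<^sup>2)" if "j < ?N" for j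
  proof -
    define I where "I = (real (2 * j + 1))\<^sup>2"
    have I: "I > 0" by (simp add: I_def)
    have "2 * j + 1 \<le> k" using that by presburger
    then have "central_ratio k (2 * j + 1) / I \<le> real k / (real k + I) / I"
      using central_ratio_le[OF k, of "2 * j + 1"] I
      by (intro divide_right_mono) (auto simp: I_def)
    also have "\<dots> = 1 / I - 1 / (real k + I)"
    proof -
      have "real k + I \<noteq> 0" using I by (simp add: add_nonneg_pos less_imp_neq[symmetric])
      then show ?thesis using I by (simp add: field_simps)
    qed
    finally show ?thesis by (simp add: I_def)
  qed
  have "1 / (8 * sqrt (real k)) = sqrt (real k) / 4 * (1 / (2 * real k))"
    using k by (simp add: field_simps flip: power2_eq_square)
  also have "\<dots> \<le> real r * (1 / (2 * real k))"
    by (rule mult_right_mono[OF r]) simp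
  also have "\<dots> = (\<Sum>j<r. 1 / (2 * real k))" by simp
  also have "\<dots> \<le> (\<Sum>j<r. 1 / (real k + (real (2 * j + 1))\<^sup>2))"
  proof (rule sum_mono)
    fix j assume "j \<in> {..<r}"
    then have "2 * j + 1 \<le> s" unfolding r_def lessThan_iff by presburger
    then have "(2 * j + 1)\<^sup>2 \<le> s\<^sup>2" by (rule power_mono) simp
    then have "real ((2 * j + 1)\<^sup>2) \<le> real k" using s2 by linarith
    then show "1 / (2 * real k) \<le> 1 / (real k + (real (2 * j + 1))\<^sup>2)"
      using k by (intro divide_left_mono) (auto intro!: mult_pos_pos add_pos_nonneg)
  qed
  also have "\<dots> \<le> (\<Sum>j<?N. 1 / (real k + (real (2 * j + 1))\<^sup>2))"
    by (rule sum_mono2) (use rN in auto)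
  finally have low: "1 / (8 * sqrt (real k)) \<le> (\<Sum>j<?N. 1 / (real k + (real (2 * j + 1))\<^sup>2))" .
  have "(\<Sum>j<?N. central_ratio k (2 * j + 1) / (real (2 * j + 1))\<^sup>2)
      \<le> (\<Sum>j<?N. 1 / (real (2 * j + 1))\<^sup>2 - 1 / (real k + (real (2 * j + 1))\<^sup>2))"
    by (rule sum_mono) (use summand in auto)
  also have "\<dots> \<le> pi\<^sup>2 / 8 - 1 / (8 * sqrt (real k))"
    using low sum_odd_squares_le[of ?N] by (simp only: sum_subtractf)
  finally show ?thesis .
qed

lemma fin_diff_zero_step:
  assumes "r \<ge> 1"
  shows "fin_diff r 0 g x = 0"
proof -
  have "fin_diff r 0 g x = (\<Sum>i\<le>r. (-1) ^ i * real (r choose i)) * g x"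
    by (simp add: fin_diff_def sum_distrib_right atLeast0AtMost)
  then show ?thesis using choose_alternating_sum[of r, where 'a = real] assms by simp
qed

text \<open>Average the central difference of \<open>g\<close> over the step \<open>t\<close> with weight \<open>h - t\<close>. The middle term
  reproduces \<open>g x\<close>; all the others become second differences of \<open>E\<close>, with coefficients
  \<open>b i = central_ratio k i / i\<^sup>2\<close> of alternating sign. The values of \<open>E\<close> at \<open>x\<close> in these differences
  combine to an alternating sum of the \<open>b i\<close>, which together with the sum of all \<open>b i\<close> leaves only
  those of odd index. Estimating each second difference separately by \<open>4 M\<close> would be too weak for
  large \<open>k\<close>.\<close>
lemma averaged_difference:
  fixes k :: nat
  assumes k: "k \<ge> 1" and h: "h > 0" and c: "c > 0"
    and d1: "\<And>x. (E has_real_derivative E1 x) (at x)"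
    and d2: "\<And>x. (E1 has_real_derivative - c * g x) (at x)"
    and W: "\<And>t y. 0 < t \<Longrightarrow> t \<le> h \<Longrightarrow> \<bar>fin_diff (2 * k) t g y\<bar> \<le> W"
    and M: "\<And>y. \<bar>E y\<bar> \<le> M"
  shows "\<bar>g x\<bar> \<le> gamma_star_even k * W
    + 8 * M / (c * h\<^sup>2) * (\<Sum>j<(k + 1) div 2. central_ratio k (2 * j + 1) / (real (2 * j + 1))\<^sup>2)"
  (is "_ \<le> _ + _ * ?O")
proof -
  define C where "C = real ((2 * k) choose k)"
  have C: "C > 0" unfolding C_def by (rule central_binomial_pos)
  define b where "b i = central_ratio k i / (real i)\<^sup>2" for i
  define \<delta> where "\<delta> i = E (x + real i * h) - 2 * E x + E (x - real i * h)" for i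
  let ?S = "\<Sum>i=1..k. (-1) ^ i * b i * \<delta> i"
  have W0: "W \<ge> 0" using W[of h x] h by linarith
  have M0: "M \<ge> 0" using M[of x] by linarith
  let ?G = "\<lambda>t. (h - t) * fin_diff (2 * k) t g (x - real k * t)"
  have lin: "((\<lambda>t. h - t) has_integral h\<^sup>2 / 2) {0..h}"
  proof -
    have "((\<lambda>t. h * t - t\<^sup>2 / 2) has_real_derivative h - t) (at t)" for t
      by (auto intro!: derivative_eq_intros)
    from has_integral_antiderivative[OF _ this, of 0 h] h show ?thesis
      by (simp add: power2_eq_square)
  qed
  have "((\<lambda>t. (h - t) * (g (x + real i * t) + g (x - real i * t))) has_integral
        - \<delta> i / (c * (real i)\<^sup>2)) {0..h}" if "i \<ge> 1" for i
    unfolding \<delta>_def by (rule weighted_symmetric_mean[OF d1 d2]) (use that h c in auto)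
  then have "((\<lambda>t. (-1) ^ k * C * (g x * (h - t) + (\<Sum>i=1..k. (-1) ^ i * central_ratio k i *
        ((h - t) * (g (x + real i * t) + g (x - real i * t)))))) has_integral
      (-1) ^ k * C * (g x * (h\<^sup>2 / 2) + (\<Sum>i=1..k. (-1) ^ i * central_ratio k i * (- \<delta> i / (c * (real i)\<^sup>2))))) {0..h}"
    by (intro has_integral_mult_right has_integral_add has_integral_sum lin) auto
  moreover have "(-1) ^ k * C * (g x * (h - t) + (\<Sum>i=1..k. (-1) ^ i * central_ratio k i *
        ((h - t) * (g (x + real i * t) + g (x - real i * t))))) = ?G t" for t
    unfolding fin_diff_central C_def
    by (simp add: distrib_left sum_distrib_left mult_ac)
  moreover have "(\<Sum>i=1..k. (-1) ^ i * central_ratio k i * (- \<delta> i / (c * (real i)\<^sup>2)))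
      = - (\<Sum>i=1..k. (-1) ^ i * b i * \<delta> i) / c"
    by (simp add: b_def sum_divide_distrib sum_negf[symmetric] mult_ac)
  ultimately have int: "(?G has_integral
      (-1) ^ k * C * (g x * (h\<^sup>2 / 2) + - (\<Sum>i=1..k. (-1) ^ i * b i * \<delta> i) / c)) {0..h}" (is "(_ has_integral ?I) _")
    by simp
  have "norm (integral {0..h} ?G) \<le> integral {0..h} (\<lambda>t. W * (h - t))"
  proof (rule Henstock_Kurzweil_Integration.integral_norm_bound_integral)
    show "?G integrable_on {0..h}" using int by blast
    show "(\<lambda>t. W * (h - t)) integrable_on {0..h}" using has_integral_mult_right[OF lin] by blast
    fix t assume t: "t \<in> {0..h}"
    have "\<bar>fin_diff (2 * k) t g (x - real k * t)\<bar> \<le> W"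
      using W[of t] t W0 fin_diff_zero_step[of "2 * k" g] k by (cases "t = 0") auto
    from mult_left_mono[OF this, of "h - t"] t
    show "norm (?G t) \<le> W * (h - t)" by (simp add: abs_mult mult.commute)
  qed
  moreover have "integral {0..h} ?G = ?I" using int by (rule integral_unique)
  moreover have "integral {0..h} (\<lambda>t. W * (h - t)) = W * (h\<^sup>2 / 2)"
    using has_integral_mult_right[OF lin] by (rule integral_unique)
  ultimately have "\<bar>?I\<bar> \<le> W * (h\<^sup>2 / 2)" by (simp only: real_norm_def)
  then have I: "C * \<bar>g x * (h\<^sup>2 / 2) - ?S / c\<bar> \<le> W * (h\<^sup>2 / 2)"
    using C by (simp add: abs_mult power_abs)
  have S: "\<bar>?S\<bar> \<le> 4 * M * ?O"
  proof -
    have b0: "b i \<ge> 0" for i by (simp add: b_def central_ratio_nonneg)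
    have b1: "b (Suc i) \<le> b i" if "i \<ge> 1" "i < k" for i
      unfolding b_def using that
      by (intro frac_le central_ratio_nonneg central_ratio_decreasing power_mono) auto
    have alt: "(\<Sum>i=1..k. (-1) ^ Suc i * b i) \<ge> 0"
      by (rule alternating_sum_nonneg) (use b0 b1 in auto)
    have "?S = (\<Sum>i=1..k. (-1) ^ i * b i * (E (x + real i * h) + E (x - real i * h)))
        + 2 * E x * (\<Sum>i=1..k. (-1) ^ Suc i * b i)"
      unfolding \<delta>_def sum_distrib_left sum.distrib[symmetric]
      by (rule sum.cong) (simp_all add: algebra_simps)
    also have "\<bar>\<dots>\<bar> \<le> (\<Sum>i=1..k. b i * (2 * M)) + 2 * M * (\<Sum>i=1..k. (-1) ^ Suc i * b i)"
    proof (rule order_trans[OF abs_triangle_ineq add_mono])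
      show "\<bar>\<Sum>i=1..k. (-1) ^ i * b i * (E (x + real i * h) + E (x - real i * h))\<bar>
          \<le> (\<Sum>i=1..k. b i * (2 * M))"
      proof (rule order_trans[OF sum_abs sum_mono])
        fix i
        have "\<bar>E (x + real i * h) + E (x - real i * h)\<bar> \<le> 2 * M"
          using M[of "x + real i * h"] M[of "x - real i * h"] by linarith
        from mult_left_mono[OF this b0[of i]]
        show "\<bar>(-1) ^ i * b i * (E (x + real i * h) + E (x - real i * h))\<bar> \<le> b i * (2 * M)"
          using b0[of i] by (simp add: abs_mult power_abs)
      qed
      show "\<bar>2 * E x * (\<Sum>i=1..k. (-1) ^ Suc i * b i)\<bar> \<le> 2 * M * (\<Sum>i=1..k. (-1) ^ Suc i * b i)"
        unfolding abs_mult abs_of_nonneg[OF alt] using M[of x]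
        by (intro mult_right_mono alt) simp
    qed
    also have "\<dots> = 2 * M * ((\<Sum>i=1..k. b i) + (\<Sum>i=1..k. (-1) ^ Suc i * b i))"
      unfolding sum_distrib_right[symmetric] distrib_left by (simp only: mult.commute)
    also have "\<dots> = 4 * M * ?O"
      unfolding alternating_plus_sum by (simp add: b_def)
    finally show ?thesis .
  qed
  have "\<bar>g x * (h\<^sup>2 / 2) - ?S / c\<bar> \<le> W * (h\<^sup>2 / 2) / C"
    using I C by (simp add: pos_le_divide_eq mult.commute)
  moreover have "\<bar>?S / c\<bar> \<le> 4 * M * ?O / c"
    using S c by (simp add: divide_right_mono)
  ultimately have "\<bar>g x * (h\<^sup>2 / 2)\<bar> \<le> W * (h\<^sup>2 / 2) / C + 4 * M * ?O / c" by linarith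
  then have "\<bar>g x\<bar> * (h\<^sup>2 / 2) \<le> W * (h\<^sup>2 / 2) / C + 4 * M * ?O / c"
    by (simp add: abs_mult)
  then have "\<bar>g x\<bar> \<le> (W * (h\<^sup>2 / 2) / C + 4 * M * ?O / c) / (h\<^sup>2 / 2)"
    by (subst pos_le_divide_eq) (use h in auto)
  also have "\<dots> = W / C + 8 * M / (c * h\<^sup>2) * ?O"
    using h c C by (simp add: field_simps)
  finally show ?thesis by (simp add: gamma_star_even_def C_def inverse_eq_divide)
qed

section \<open>The inequality between norm and modulus of smoothness\<close>

lemma cont_periodic_bounded:
  assumes f: "cont_periodic f"
  obtains B where "\<And>x. \<bar>f x\<bar> \<le> B"
proof -
  note fI = cont_periodic_continuous_on[OF f continuous_on_id]
  obtain B where B: "\<And>y. y \<in> {0..2 * pi} \<Longrightarrow> \<bar>f y\<bar> \<le> B"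
    using compact_imp_bounded[OF compact_continuous_image[OF fI[of "{0..2 * pi}"] compact_Icc]]
    unfolding bounded_real by blast
  interpret periodic_fun_simple f "2 * pi"
    by standard (use f in \<open>simp add: cont_periodic_def\<close>)
  have "\<bar>f x\<bar> \<le> B" for x
  proof -
    define m where "m = \<lfloor>x / (2 * pi)\<rfloor>"
    have "of_int m \<le> x / (2 * pi)" "x / (2 * pi) \<le> of_int m + 1"
      unfolding m_def by linarith+
    then have "x - of_int m * (2 * pi) \<in> {0..2 * pi}" by (simp add: field_simps)
    from B[OF this] show ?thesis by (simp only: minus_of_int)
  qed
  then show thesis using that by blast
qed

lemma unif_norm_upper:
  assumes "\<And>x. \<bar>f x\<bar> \<le> B"
  shows "\<bar>f x\<bar> \<le> unif_norm f"
  unfolding unif_norm_def by (rule cSUP_upper) (use assms in \<open>auto intro!: bdd_aboveI2\<close>)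

lemma unif_norm_least:
  assumes "\<And>x. \<bar>f x\<bar> \<le> B"
  shows "unif_norm f \<le> B"
  unfolding unif_norm_def by (rule cSUP_least) (use assms in auto)

lemma fin_diff_bound:
  assumes "\<And>x. \<bar>f x\<bar> \<le> B"
  shows "\<bar>fin_diff r t f x\<bar> \<le> (\<Sum>i=0..r. real (r choose i) * B)"
  unfolding fin_diff_def
  by (rule order_trans[OF sum_abs sum_mono])
    (use assms in \<open>simp add: abs_mult power_abs mult_left_mono\<close>)

lemma fin_diff_le_mod_smooth:
  assumes B: "\<And>x. \<bar>f x\<bar> \<le> B" and t: "0 < t" "t \<le> \<delta>"
  shows "\<bar>fin_diff r t f x\<bar> \<le> mod_smooth r f \<delta>"
proof -
  have "\<bar>fin_diff r t f x\<bar> \<le> unif_norm (fin_diff r t f)"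
    by (rule unif_norm_upper[OF fin_diff_bound[OF B]])
  also have "\<dots> \<le> mod_smooth r f \<delta>"
    unfolding mod_smooth_def
    by (rule cSUP_upper) (use t unif_norm_least[OF fin_diff_bound[OF B]] in \<open>auto intro!: bdd_aboveI2\<close>)
  finally show ?thesis .
qed

text \<open>The operators commute with translations, hence with differences, so the difference of the image is
  the image of the difference.\<close>
lemma fin_diff_inverse_power_op_bound:
  assumes f: "cont_periodic f" and n: "n \<ge> 1" and t: "0 < t" "t \<le> \<delta>"
  shows "\<bar>fin_diff r t (inverse_power_op n m f) x\<bar> \<le> 3 * mod_smooth r f \<delta>"
proof -
  obtain B where B: "\<And>x. \<bar>f x\<bar> \<le> B" using cont_periodic_bounded[OF f] by blast
  have eq: "fin_diff r t g = (\<lambda>x. \<Sum>i\<in>{0..r}. ((-1) ^ i * real (r choose i)) * g (x + real i * t))" for g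
    by (simp add: fin_diff_def fun_eq_iff)
  have per: "cont_periodic (fin_diff r t f)"
  proof -
    have "f (x + 2 * pi + real i * t) = f (x + real i * t)" for x i
    proof -
      have e: "x + 2 * pi + real i * t = (x + real i * t) + 2 * pi" by simp
      show ?thesis using f unfolding cont_periodic_def e by blast
    qed
    then show ?thesis
      unfolding cont_periodic_def eq
      by (auto intro!: continuous_intros cont_periodic_continuous_on[OF f])
  qed
  have "fin_diff r t (inverse_power_op n m f) x = inverse_power_op n m (fin_diff r t f) x"
    unfolding eq by (rule inverse_power_op_translates[OF f, symmetric]) simp
  then show ?thesis
    using inverse_power_op_bound[OF per n fin_diff_le_mod_smooth[OF B t]] by simp
qed

text \<open>Let \<open>M\<close> bound all functions \<open>D m\<close> simultaneously. The averaged difference bounds \<open>D m\<close> by the modulus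
  of smoothness and \<open>\<rho> M\<close>, where \<open>M\<close> comes from \<open>D (m + 1)\<close>. As this holds for every \<open>m\<close>, it
  bounds \<open>M\<close> itself, and \<open>1 - \<rho> \<ge> 1 / (\<pi>\<^sup>2 sqrt k)\<close> allows it to be solved for \<open>M\<close>.\<close>
lemma trig_perp_norm_bound:
  assumes k: "k \<ge> 1" and n: "n \<ge> 1" and f: "f \<in> trig_perp (n - 1)"
  shows "unif_norm f \<le> 3 * pi\<^sup>2 * sqrt (real k) * gamma_star_even k * mod_smooth (2 * k) f (pi / real n)"
proof -
  define \<omega> where "\<omega> = mod_smooth (2 * k) f (pi / real n)"
  define D where "D m = inverse_power_op n m f" for m
  define \<rho> where "\<rho> = 8 / pi\<^sup>2 *
    (\<Sum>j<(k + 1) div 2. central_ratio k (2 * j + 1) / (real (2 * j + 1))\<^sup>2)"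
  have per: "cont_periodic f" using f by (simp add: trig_perp_def)
  obtain B where B: "\<And>x. \<bar>f x\<bar> \<le> B" using cont_periodic_bounded[OF per] by blast
  define M where "M = (SUP (m, x)\<in>UNIV. \<bar>D m x\<bar>)"
  have DM: "\<bar>D m x\<bar> \<le> M" for m x
  proof -
    have "bdd_above (range (\<lambda>(m, x). \<bar>D m x\<bar>))"
      using inverse_power_op_bound[OF per n B] by (auto simp: D_def intro!: bdd_aboveI2[of _ _ "3 * B"])
    from cSUP_upper[OF UNIV_I this, of "(m, x)"] show ?thesis by (simp add: M_def)
  qed
  have step: "\<bar>D m x\<bar> \<le> gamma_star_even k * (3 * \<omega>) + \<rho> * M" for m x
  proof -
    obtain E1 where E1: "\<And>x. (D (Suc m) has_real_derivative E1 x) (at x)"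
      "\<And>x. (E1 has_real_derivative - (real n)\<^sup>2 * D m x) (at x)"
      using inverse_power_op_derivatives[OF f n, of m] unfolding D_def by blast
    have "\<bar>D m x\<bar> \<le> gamma_star_even k * (3 * \<omega>) + 8 * M / ((real n)\<^sup>2 * (pi / real n)\<^sup>2) *
        (\<Sum>j<(k + 1) div 2. central_ratio k (2 * j + 1) / (real (2 * j + 1))\<^sup>2)"
    proof (rule averaged_difference[OF k _ _ E1 _ DM])
      show "\<bar>fin_diff (2 * k) t (D m) y\<bar> \<le> 3 * \<omega>" if "0 < t" "t \<le> pi / real n" for t y
        unfolding D_def \<omega>_def by (rule fin_diff_inverse_power_op_bound[OF per n that])
    qed (use n in auto)
    also have "(real n)\<^sup>2 * (pi / real n)\<^sup>2 = pi\<^sup>2"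
      using n by (simp add: power_divide)
    finally show ?thesis by (simp add: \<rho>_def mult_ac)
  qed
  have M: "M \<le> gamma_star_even k * (3 * \<omega>) + \<rho> * M"
    unfolding M_def by (rule cSUP_least) (use step[unfolded M_def] in auto)
  have sq: "sqrt (real k) > 0" using k by simp
  have "\<rho> \<le> 8 / pi\<^sup>2 * (pi\<^sup>2 / 8 - 1 / (8 * sqrt (real k)))"
    unfolding \<rho>_def by (intro mult_left_mono odd_central_sum_le[OF k]) simp
  also have "\<dots> = 1 - 1 / (pi\<^sup>2 * sqrt (real k))"
    using sq by (simp add: field_simps)
  finally have rho: "1 / (pi\<^sup>2 * sqrt (real k)) \<le> 1 - \<rho>" by simp
  have M0: "M \<ge> 0" using DM[of 0 0] by linarith
  have "M * (1 / (pi\<^sup>2 * sqrt (real k))) \<le> M * (1 - \<rho>)"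
    by (rule mult_left_mono[OF rho M0])
  also have "\<dots> \<le> gamma_star_even k * (3 * \<omega>)" using M by (simp add: algebra_simps)
  finally have "M \<le> gamma_star_even k * (3 * \<omega>) * (pi\<^sup>2 * sqrt (real k))"
    using sq by (simp add: pos_divide_le_eq)
  moreover have "unif_norm f \<le> M"
    by (rule unif_norm_least) (use DM[of 0] in \<open>simp add: D_def inverse_power_op_def\<close>)
  ultimately show ?thesis by (simp add: \<omega>_def mult_ac)
qed

theorem theorem4p6:
  shows "\<exists>c :: nat \<Rightarrow> real.
    (\<lambda>k. c (2 * k)) \<in> O(\<lambda>k. sqrt (real (2 * k))) \<and>
    (\<forall>k n :: nat. \<forall>f. k \<ge> 1 \<longrightarrow> n \<ge> 1 \<longrightarrow> f \<in> trig_perp (n - 1) \<longrightarrow>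
       unif_norm f \<le> c (2 * k) * gamma_star_even k * mod_smooth (2 * k) f (pi / real n))"
proof (intro exI conjI allI impI)
  let ?c = "\<lambda>r::nat. 3 * pi\<^sup>2 * sqrt (real r / 2)"
  show "(\<lambda>k. ?c (2 * k)) \<in> O(\<lambda>k. sqrt (real (2 * k)))"
    by (rule bigoI[of _ "3 * pi\<^sup>2"]) (simp add: abs_mult)
  fix k n :: nat and f
  assume "k \<ge> 1" "n \<ge> 1" "f \<in> trig_perp (n - 1)"
  from trig_perp_norm_bound[OF this]
  show "unif_norm f \<le> ?c (2 * k) * gamma_star_even k * mod_smooth (2 * k) f (pi / real n)"
    by simp
qed

end
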